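(* Suppose that $\ell$ spans an extreme ray of $\Sigma_{4,4}^*$. Then $\operatorname{rank} Q_{\ell}=1$ or $\operatorname{rank} Q_{\ell}=6$.
   Context: $H_{n,d}$ is the real vector space of real forms (homogeneous polynomials) of degree $d$ in $n$ variables. $\Sigma_{n,2d}=\{p\in H_{n,2d} : p=\sum_i q_i^2 \text{ (finite sum) for some } q_i\in H_{n,d}\}$, and $\Sigma_{n,2d}^*=\{\ell\in H_{n,2d}^* : \ell(p)\ge 0 \text{ for all } p\in\Sigma_{n,2d}\}$ is its dual cone in the dual space $H_{n,2d}^*$. For $\ell\in H_{n,2d}^*$, $Q_\ell$ is the quadratic form on $H_{n,d}$ given by $Q_\ell(f)=\ell(f^2)$. *)

theory Defs
  imports "HOL-Analysis.Analysis" "HOL-Analysis.Finite_Function_Topology" "HOL-Library.Function_Algebras"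
begin

text \<open>Real-valued functions form a real vector space under the pointwise operations; dual spaces
  are subspaces of function spaces.\<close>

instantiation "fun" :: (type, real_vector) real_vector
begin

definition scaleR_fun :: "real \<Rightarrow> ('a \<Rightarrow> 'b) \<Rightarrow> 'a \<Rightarrow> 'b"
  where "scaleR_fun c f = (\<lambda>x. c *\<^sub>R f x)"

instance
  by standard (simp_all add: scaleR_fun_def fun_eq_iff algebra_simps)

end

text \<open>Real polynomials in the variables \<open>x\<^sub>0, x\<^sub>1, \<dots>\<close>: a monomial is its finitely supported
  exponent vector, a polynomial its finitely supported coefficient function. Multiplication is the
  convolution product of \<^theory>\<open>HOL-Library.Poly_Mapping\<close>.\<close>

type_synonym real_mpoly = "(nat \<Rightarrow>\<^sub>0 nat) \<Rightarrow>\<^sub>0 real"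

definition monom_degree :: "(nat \<Rightarrow>\<^sub>0 nat) \<Rightarrow> nat"
  where "monom_degree m = (\<Sum>i\<in>Poly_Mapping.keys m. Poly_Mapping.lookup m i)"

text \<open>The space \<open>H\<^bsub>n,d\<^esub>\<close> of forms of degree \<open>d\<close> in \<open>x\<^sub>0, \<dots>, x\<^bsub>n-1\<^esub>\<close> (including \<open>0\<close>).\<close>

definition forms :: "nat \<Rightarrow> nat \<Rightarrow> real_mpoly set"
  where "forms n d =
    {p. \<forall>m\<in>Poly_Mapping.keys p. Poly_Mapping.keys m \<subseteq> {..<n} \<and> monom_degree m = d}"

text \<open>The dual space of a linear subspace \<open>V\<close>. A functional on \<open>V\<close> is represented by a total function;
  its value outside \<open>V\<close> is fixed to be \<open>0\<close>, so that equality of functions is equality of functionals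
  on \<open>V\<close> and the vector space operations are the pointwise ones.\<close>

definition dual_space :: "'a::real_vector set \<Rightarrow> ('a \<Rightarrow> real) set"
  where "dual_space V = {l.
     (\<forall>p\<in>V. \<forall>q\<in>V. l (p + q) = l p + l q) \<and>
     (\<forall>c. \<forall>p\<in>V. l (c *\<^sub>R p) = c * l p) \<and>
     (\<forall>p. p \<notin> V \<longrightarrow> l p = 0)}"

text \<open>The cones \<open>\<Sigma>\<^bsub>n,2d\<^esub>\<close> and \<open>\<Sigma>\<^bsub>n,2d\<^esub>\<^sup>*\<close>; the second argument of both constants is \<open>d\<close>, half the degree.\<close>

definition sos_cone :: "nat \<Rightarrow> nat \<Rightarrow> real_mpoly set"
  where "sos_cone n d = {p \<in> forms n (2 * d).
     \<exists>(k::nat) q. (\<forall>i<k. q i \<in> forms n d) \<and> p = (\<Sum>i<k. (q i)\<^sup>2)}"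

definition sos_dual_cone :: "nat \<Rightarrow> nat \<Rightarrow> (real_mpoly \<Rightarrow> real) set"
  where "sos_dual_cone n d = {l \<in> dual_space (forms n (2 * d)). \<forall>p\<in>sos_cone n d. 0 \<le> l p}"

definition spans_extreme_ray :: "'a::real_vector \<Rightarrow> 'a set \<Rightarrow> bool"
  where "spans_extreme_ray x K \<longleftrightarrow> x \<noteq> 0 \<and> {c *\<^sub>R x |c. 0 \<le> c} face_of K"

definition Q_form :: "(real_mpoly \<Rightarrow> real) \<Rightarrow> real_mpoly \<Rightarrow> real"
  where "Q_form l f = l (f\<^sup>2)"

text \<open>The rank of a quadratic form \<open>Q\<close> on \<open>V\<close> is the rank of its polar symmetric bilinear form \<open>B\<close>,
  that is, the dimension of the image of the linear map \<open>f \<mapsto> B(f, \<cdot>)\<close> from \<open>V\<close> to its dual space.\<close>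

definition polar_form :: "('a::real_vector \<Rightarrow> real) \<Rightarrow> 'a \<Rightarrow> 'a \<Rightarrow> real"
  where "polar_form Q f g = (Q (f + g) - Q f - Q g) / 2"

definition quadratic_form_rank :: "'a::real_vector set \<Rightarrow> ('a \<Rightarrow> real) \<Rightarrow> nat"
  where "quadratic_form_rank V Q =
    dim ((\<lambda>f g. if g \<in> V then polar_form Q f g else 0) ` V)"

end

(* With b(f, g) = l(f g) on H_2 and W its kernel, extremality of l says that the products of W with
   H_2 span a hyperplane of H_4: a functional l' that vanishes on them satisfies |l'(f^2)| <= C l(f^2),
   so l + t l' stays in the cone for small |t|. As dim H_4 = 35, this forces dim W >= 4, i.e. rank <= 6.

   Now let the rank be at most 5. A real point z whose evaluation vanishes on W makes l proportional to
   that evaluation, which has rank 1. To find z, choose a linear form a for which multiplication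
   H_1 -> H_2 / W has the smallest kernel; by positivity this kernel is N = {x. x^2 in W}, and a dimension
   count shows that a H_1 has codimension at most one in H_2 / W. Let n span its orthogonal complement and
   diagonalize x, y |-> b(a x, a y) and x, y |-> b(n, x y) simultaneously, with basis y_i and entries s_i of
   the second form. If exactly one s_i is nonzero, n itself is an evaluation. Otherwise multiplication by
   y_i / a, a priori defined only on a H_1, extends to H_2 / W by symmetry up to one scalar v_i. The
   matrices T_i = (l(a y_i y_j y_k))_jk satisfy [T_i, T_j] = - (1 + s_i s_j) (E_ij - E_ji), and the Jacobi
   identity for them is exactly what allows to choose the v_i so that the extensions commute. A joint
   eigenvector of these commuting self-adjoint operators is the required evaluation. *)

theory Submission
  imports Defs
begin

subsection \<open>Simultaneous diagonalization\<close>

text \<open>The dimension count behind codimension at most one, with k = dim H_1 / N: a H_1 has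
  dimension k in H_2 / W, and k (k + 1) / 2 products span H_2 / W, which settles k <= 2. For k = 4
  the bound 5 on the rank is enough. For k = 3 some nonzero x lies in N, so x H_1 lies in W; the
  products of x H_1 with H_2 stay in x H_3 and are too few, so W must be larger and the rank is at
  most 4. The obstacle is the single direction n. Without it multiplication by y_i / a is defined on
  all of H_2 / W. With it, self-adjointness determines the extension except for its entry v_i at (n,
  n), and commutation becomes the linear system (s_j - s_i) t_ijk = delta_jk s_j v_i - delta_ik s_i
  v_j. If s_i is the only nonzero entry, this system would force t_ijj = 0 for the other j; that is
  why this case is treated apart. Self-adjointness makes the joint eigenvalues real. They are the
  coordinates of z in the basis y_i, scaled so that a takes the value 1 at z.\<close>

lemma psd_bilinear_null:
  assumes "bilinear P" and sym: "\<And>x y. P x y = P y x" and "subspace Y"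
    and psd: "\<And>x. x \<in> Y \<Longrightarrow> 0 \<le> P x x" and "y \<in> Y" "P y y = (0::real)" "x \<in> Y"
  shows "P y x = 0"
proof (rule ccontr)
  assume nz: "P y x \<noteq> 0"
  \<comment> \<open>Because \<open>P y y = 0\<close>, the value of the form at
    \<open>x + t y\<close> is affine in \<open>t\<close>; this \<open>t\<close> makes it -1.\<close>
  define t where "t = - (P x x + 1) / (2 * P y x)"
  have "x + t *\<^sub>R y \<in> Y"
    using assms by (simp add: subspace_add subspace_scale)
  from psd[OF this] have "0 \<le> P x x + 2 * t * P y x"
    using assms(6) sym[of x y]
    by (simp add: bilinear_ladd[OF assms(1)] bilinear_radd[OF assms(1)]
        bilinear_lmul[OF assms(1)] bilinear_rmul[OF assms(1)] algebra_simps)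
  also have "\<dots> = -1" using nz by (simp add: t_def field_simps)
  finally show False by simp
qed

text \<open>Maximize the Rayleigh quotient \<open>s y y / g y y\<close> over the unit sphere of
  \<open>Y\<close>. With maximum \<open>c\<close>, the form \<open>c g - s\<close> is semidefinite
  on \<open>Y\<close> and vanishes at the maximizer, so the maximizer is orthogonal to all of
  \<open>Y\<close> for it.\<close>

lemma generalized_eigenvector:
  fixes Y :: "'e::euclidean_space set" and g s :: "'e \<Rightarrow> 'e \<Rightarrow> real"
  assumes Y: "subspace Y" "Y \<noteq> {0}"
    and g: "bilinear g" "\<And>x y. g x y = g y x" "\<And>y. y \<in> Y \<Longrightarrow> y \<noteq> 0 \<Longrightarrow> 0 < g y y"
    and s: "bilinear s" "\<And>x y. s x y = s y x"
  obtains y c where "y \<in> Y" "g y y = 1" "\<And>x. x \<in> Y \<Longrightarrow> s y x = c * g y x"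
proof -
  define S where "S = Y \<inter> sphere 0 1"
  obtain u where u: "u \<in> Y" "u \<noteq> 0" using Y subspace_0 by blast
  have "u /\<^sub>R norm u \<in> S" using u Y by (simp add: S_def subspace_scale)
  hence "S \<noteq> {}" by blast
  moreover have "compact S"
    unfolding S_def by (intro closed_Int_compact closed_subspace Y compact_sphere)
  moreover have cont: "continuous_on S (\<lambda>y. h y y)" if "bilinear h" for h :: "'e \<Rightarrow> 'e \<Rightarrow> real"
    using bounded_bilinear.continuous_on[OF that[unfolded bilinear_conv_bounded_bilinear]
        continuous_on_id continuous_on_id] .
  have "continuous_on S (\<lambda>y. s y y / g y y)"
    using g(3) by (intro continuous_on_divide cont g s) (force simp: S_def)
  ultimately obtain y where y: "y \<in> S" "\<And>x. x \<in> S \<Longrightarrow> s x x / g x x \<le> s y y / g y y"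
    using continuous_attains_sup by meson
  define c where "c = s y y / g y y"
  have yY: "y \<in> Y" "y \<noteq> 0" using y by (auto simp: S_def)
  note gy = g(3)[OF this]
  define P where "P = (\<lambda>u v. c * g u v - s u v)"
  have P: "bilinear P"
    using g(1) s(1) by (simp add: P_def bilinear_def linear_iff algebra_simps)
  have Psym: "P u v = P v u" for u v
    unfolding P_def using g(2) s(2) by simp
  have psd: "0 \<le> P x x" if "x \<in> Y" for x
  proof (cases "x = 0")
    case True
    then show ?thesis using bilinear_lzero[OF P] by simp
  next
    case False
    let ?x = "x /\<^sub>R norm x"
    have "?x \<in> S" using that Y False by (simp add: S_def subspace_scale)
    from y(2)[OF this] have "s x x / g x x \<le> c"
      using False by (simp add: c_def bilinear_lmul[OF g(1)] bilinear_rmul[OF g(1)]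
        bilinear_lmul[OF s(1)] bilinear_rmul[OF s(1)])
    thus ?thesis using g(3)[OF that False] by (simp add: P_def field_simps)
  qed
  have "P y y = 0" using gy by (simp add: P_def c_def)
  hence null: "s y x = c * g y x" if "x \<in> Y" for x
    using psd_bilinear_null[OF P Psym Y(1) psd yY(1) _ that] by (simp add: P_def)
  show thesis
  proof (rule that[of "y /\<^sub>R sqrt (g y y)" c])
    show "y /\<^sub>R sqrt (g y y) \<in> Y" using yY Y by (simp add: subspace_scale)
    show "g (y /\<^sub>R sqrt (g y y)) (y /\<^sub>R sqrt (g y y)) = 1"
      using gy by (simp add: bilinear_lmul[OF g(1)] bilinear_rmul[OF g(1)] field_simps)
    show "s (y /\<^sub>R sqrt (g y y)) x = c * g (y /\<^sub>R sqrt (g y y)) x" if "x \<in> Y" for x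
      using null[OF that] by (simp add: bilinear_lmul[OF g(1)] bilinear_lmul[OF s(1)])
  qed
qed

text \<open>Split off a generalized eigenvector \<open>y\<close> and pass to its
  \<open>g\<close>-complement in \<open>Y\<close>. There \<open>s y\<close> is a multiple of
  \<open>g y\<close>, so \<open>g\<close>-orthogonality to \<open>y\<close> brings
  \<open>s\<close>-orthogonality with it.\<close>

lemma simultaneous_diagonalization:
  fixes Y :: "'e::euclidean_space set" and g s :: "'e \<Rightarrow> 'e \<Rightarrow> real"
  assumes "subspace Y"
    and g: "bilinear g" "\<And>x y. g x y = g y x" "\<And>y. y \<in> Y \<Longrightarrow> y \<noteq> 0 \<Longrightarrow> 0 < g y y"
    and s: "bilinear s" "\<And>x y. s x y = s y x"
  shows "\<exists>B. finite B \<and> card B \<le> dim Y \<and> B \<subseteq> Y \<and> Y \<subseteq> span B \<and>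
    (\<forall>b\<in>B. g b b = 1) \<and> (\<forall>b\<in>B. \<forall>c\<in>B. b \<noteq> c \<longrightarrow> g b c = 0 \<and> s b c = 0)"
  using assms(1) g(3)
proof (induction "dim Y" arbitrary: Y rule: less_induct)
  case (less Y)
  show ?case
  proof (cases "Y = {0}")
    case True
    then show ?thesis by (intro exI[of _ "{}"]) auto
  next
    case False
    obtain y c where y: "y \<in> Y" "g y y = 1" "\<And>x. x \<in> Y \<Longrightarrow> s y x = c * g y x"
      using generalized_eigenvector[OF less.prems(1) False g(1,2) less.prems(2) s] by blast
    define Y' where "Y' = {x \<in> Y. g y x = 0}"
    have subY': "subspace Y'"
      using less.prems(1) unfolding Y'_def subspace_def
      by (auto simp: bilinear_radd[OF g(1)] bilinear_rmul[OF g(1)] bilinear_rzero[OF g(1)])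
    have "y \<notin> Y'" using y by (simp add: Y'_def)
    moreover have "Y' \<subseteq> Y" by (auto simp: Y'_def)
    ultimately have "Y' \<subset> Y" using y(1) by blast
    hence dimlt: "dim Y' < dim Y"
      using subY' less.prems(1) by (metis dim_psubset span_eq_iff)
    have "\<And>x. x \<in> Y' \<Longrightarrow> x \<noteq> 0 \<Longrightarrow> 0 < g x x" using less.prems(2) by (auto simp: Y'_def)
    from less.hyps[OF dimlt subY' this] obtain B where B: "finite B" "card B \<le> dim Y'" "B \<subseteq> Y'"
      "Y' \<subseteq> span B" "\<forall>b\<in>B. g b b = 1" "\<forall>b\<in>B. \<forall>c\<in>B. b \<noteq> c \<longrightarrow> g b c = 0 \<and> s b c = 0"
      by blast
    have yB: "g y b = 0 \<and> s y b = 0 \<and> g b y = 0 \<and> s b y = 0" if "b \<in> B" for b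
      using that B(3) y(3)[of b] g(2)[of b y] s(2)[of b y] by (auto simp: Y'_def)
    have "Y \<subseteq> span (insert y B)"
    proof
      fix x assume x: "x \<in> Y"
      have "x - g y x *\<^sub>R y \<in> Y'"
        using x y less.prems(1)
        by (simp add: Y'_def subspace_diff subspace_scale bilinear_rsub[OF g(1)] bilinear_rmul[OF g(1)])
      hence "x - g y x *\<^sub>R y \<in> span (insert y B)"
        using B(4) span_mono[of B "insert y B"] by blast
      moreover have "g y x *\<^sub>R y \<in> span (insert y B)" by (simp add: span_base span_scale)
      ultimately show "x \<in> span (insert y B)" by (metis diff_add_cancel span_add)
    qed
    moreover have "card (insert y B) \<le> dim Y"
      using B(1,2) dimlt by (simp add: card_insert_if)
    moreover have "insert y B \<subseteq> Y" using B(3) y(1) by (auto simp: Y'_def)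
    moreover have "\<forall>b\<in>insert y B. \<forall>c\<in>insert y B. b \<noteq> c \<longrightarrow> g b c = 0 \<and> s b c = 0"
      using B(6) yB by blast
    ultimately show ?thesis
      using B(1,5) y(2) by (intro exI[of _ "insert y B"]) simp
  qed
qed

text \<open>The eigenspace of one operator inside \<open>C\<close> is invariant under the operators
  that commute with it, so the induction needs an arbitrary invariant subspace
  \<open>C\<close>.\<close>

lemma joint_eigenvector:
  fixes N :: "'i \<Rightarrow> 'e::euclidean_space \<Rightarrow> 'e"
  assumes "finite I" and "\<And>i. i \<in> I \<Longrightarrow> linear (N i)"
    and "\<And>i x y. i \<in> I \<Longrightarrow> N i x \<bullet> y = x \<bullet> N i y"
    and "\<And>i j x. i \<in> I \<Longrightarrow> j \<in> I \<Longrightarrow> N i (N j x) = N j (N i x)"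
    and "subspace C" "C \<noteq> {0}" "\<And>i x. i \<in> I \<Longrightarrow> x \<in> C \<Longrightarrow> N i x \<in> C"
  shows "\<exists>v\<in>C. v \<noteq> 0 \<and> (\<forall>i\<in>I. \<exists>c. N i v = c *\<^sub>R v)"
  using assms
proof (induction I arbitrary: C rule: finite_induct)
  case empty
  then show ?case using subspace_0 by auto
next
  case (insert i I)
  have lin: "linear (N i)" and sa: "N i x \<bullet> y = x \<bullet> N i y" for x y
    using insert.prems by auto
  have bN: "bilinear (\<lambda>x y. x \<bullet> N i y)"
    using lin by (auto simp: bilinear_def linear_iff inner_add_left inner_add_right)
  have bi: "bilinear ((\<bullet>) :: 'e \<Rightarrow> 'e \<Rightarrow> real)"
    by (simp add: bilinear_conv_bounded_bilinear bounded_bilinear_inner)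
  have sN: "x \<bullet> N i y = y \<bullet> N i x" for x y
    using sa[of x y] by (simp add: inner_commute)
  obtain y c where y: "y \<in> C" "y \<bullet> y = 1" and yc: "\<And>x. x \<in> C \<Longrightarrow> y \<bullet> N i x = c * (y \<bullet> x)"
  proof (rule generalized_eigenvector[OF insert.prems(4,5) bi inner_commute _ bN sN])
    show "0 < y \<bullet> y" if "y \<noteq> 0" for y :: 'e using that by simp
  qed (use that in blast)
  \<comment> \<open>So far the eigenvalue equation holds only when tested against \<open>C\<close>.
    The residual lies in \<open>C\<close> by invariance and may therefore be tested against
    itself.\<close>
  have "N i y - c *\<^sub>R y \<in> C"
    using y insert.prems by (simp add: subspace_diff subspace_scale)
  from yc[OF this] have "(N i y - c *\<^sub>R y) \<bullet> (N i y - c *\<^sub>R y) = 0"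
    using sa by (simp add: inner_diff_left inner_diff_right inner_commute linear_diff[OF lin] linear_scale[OF lin] right_diff_distrib)
  hence Niy: "N i y = c *\<^sub>R y" by simp
  define C' where "C' = {x \<in> C. N i x = c *\<^sub>R x}"
  have "subspace C'"
    using insert.prems(4) lin unfolding C'_def subspace_def
    by (auto simp: linear_0 linear_add linear_scale scaleR_add_right)
  moreover have "y \<in> C'" using y(1) Niy by (simp add: C'_def)
  hence "C' \<noteq> {0}" using y(2) by auto
  moreover have "N j x \<in> C'" if "j \<in> I" "x \<in> C'" for j x
    using that insert.prems(3)[of i j x] insert.prems(6)[of j x] linear_scale[OF insert.prems(1)[of j]]
    by (simp add: C'_def)
  ultimately obtain v where "v \<in> C'" "v \<noteq> 0" "\<forall>j\<in>I. \<exists>c. N j v = c *\<^sub>R v"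
    using insert.IH[OF insert.prems(1,2,3), of C'] by blast
  then show ?case by (auto simp: C'_def)
qed

subsection \<open>Almost flat tensors\<close>

text \<open>The data are \<open>t i j k = \<langle>a y\<^sub>i, y\<^sub>j y\<^sub>k\<rangle>\<close>, \<open>s i = \<langle>n, y\<^sub>i\<^sup>2\<rangle>\<close> and \<open>e i = \<langle>a y\<^sub>i, a y\<^sub>i\<rangle>\<close>. The index type is fixed,
  so shorter bases are padded with zero vectors, for which \<open>e i = 0\<close>. The last axiom is the symmetry of
  \<open>\<langle>y\<^sub>i y\<^sub>j, y\<^sub>k y\<^sub>l\<rangle>\<close> in \<open>j\<close> and \<open>k\<close>, expanded in the orthonormal basis \<open>a\<^sup>2, (a y\<^sub>m), n\<close>.\<close>

locale almost_flat_tensor =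
  fixes t :: "'n::finite \<Rightarrow> 'n \<Rightarrow> 'n \<Rightarrow> real" and s e :: "'n \<Rightarrow> real"
  assumes t12: "t i j k = t j i k" and t23: "t i j k = t i k j"
    and e01: "e i = 0 \<or> e i = 1"
    and s0: "e i = 0 \<Longrightarrow> s i = 0" and t0: "e i = 0 \<Longrightarrow> t i j k = 0"
    and exch: "of_bool (i = j) * of_bool (k = l) * (e i * e k + s i * s k) + (\<Sum>m\<in>UNIV. t i j m * t k l m) =
       of_bool (i = k) * of_bool (j = l) * (e i * e j + s i * s j) + (\<Sum>m\<in>UNIV. t i k m * t j l m)"
begin

lemma et [simp]: "e i * t i j k = t i j k" "e j * t i j k = t i j k" "e k * t i j k = t i j k"
proof -
  show 1: "e i * t i j k = t i j k" for i j k using e01[of i] t0[of i j k] by auto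
  show 2: "e j * t i j k = t i j k" for i j k using 1[of j i k] by (simp add: t12[of i j])
  show "e k * t i j k = t i j k" using 2[of k i j] by (simp add: t23[of i j])
qed

text \<open>The factor \<open>1 + s_i s_j\<close> of the overview; the product of the
  \<open>e\<close> replaces 1 so that padded indices contribute nothing.\<close>

definition curv :: "'n \<Rightarrow> 'n \<Rightarrow> real" where "curv i j = e i * e j + s i * s j"

text \<open>Entry \<open>(a, b)\<close> of the commutator of the matrices of \<open>t p\<close> and
  \<open>t q\<close>. It is \<open>exch\<close> for the two ways to group the factors
  \<open>y_a, y_p, y_q, y_b\<close> with \<open>y_a\<close> next to \<open>y_p\<close> or next to
  \<open>y_q\<close>.\<close>

lemma commutator:
  "(\<Sum>m\<in>UNIV. t p a m * t q m b) - (\<Sum>m\<in>UNIV. t q a m * t p m b) =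
   - curv p q * (of_bool (p = a) * of_bool (q = b) - of_bool (q = a) * of_bool (p = b))"
proof -
  have *: "(\<Sum>m\<in>UNIV. t x a m * t y m b) = (\<Sum>m\<in>UNIV. t a x m * t y b m)" for x y
    by (simp only: t12[of x a] t23[of y _ b])
  have "of_bool (a = p) * of_bool (q = b) * (e a * e q + s a * s q) = curv p q * (of_bool (p = a) * of_bool (q = b))"
    by (cases "a = p") (simp_all add: curv_def)
  moreover have "of_bool (a = q) * of_bool (p = b) * (e a * e p + s a * s p) = curv p q * (of_bool (q = a) * of_bool (p = b))"
    by (cases "a = q") (simp_all add: curv_def mult.commute)
  ultimately show ?thesis
    using exch[of a p q b] unfolding * right_diff_distrib by linarith
qed

lemma curv_sym: "curv i j = curv j i"
  by (simp add: curv_def mult.commute)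

lemma curv_mult:
  assumes "e j * x = x"
  shows "x * curv i j = e i * x + s i * s j * x"
proof -
  have "x * curv i j = e i * (e j * x) + s i * s j * x"
    by (simp only: curv_def distrib_left mult_ac)
  thus ?thesis unfolding assms .
qed

lemma sum_delta: "(\<Sum>k\<in>UNIV. of_bool (q = k) * f k) = f q" for f :: "'n \<Rightarrow> real"
proof -
  have "of_bool (q = k) * f k = (if q = k then f k else 0)" for k by simp
  thus ?thesis by simp
qed

text \<open>Entry \<open>(a, b)\<close> of the Jacobi identity for the matrices \<open>t p\<close>,
  \<open>t q\<close>, \<open>t r\<close>, with each inner commutator replaced by its value from
  \<open>commutator\<close>. The associative triple products cancel in the cyclic sum.\<close>

lemma bianchi:
  "curv p q * (of_bool (p = a) * t r q b - of_bool (q = a) * t r p b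
     - t r a p * of_bool (q = b) + t r a q * of_bool (p = b)) +
   curv q r * (of_bool (q = a) * t p r b - of_bool (r = a) * t p q b
     - t p a q * of_bool (r = b) + t p a r * of_bool (q = b)) +
   curv r p * (of_bool (r = a) * t q p b - of_bool (p = a) * t q r b
     - t q a r * of_bool (p = b) + t q a p * of_bool (r = b)) = 0"
proof -
  \<comment> \<open>Entry \<open>(a, b)\<close> of the matrix product of \<open>t p\<close>,
    \<open>t q\<close> and \<open>t r\<close>.\<close>
  define P where "P p q r = (\<Sum>m\<in>UNIV. \<Sum>k\<in>UNIV. t p a m * t q m k * t r k b)" for p q r
  have left: "P p q r - P q p r = - curv p q * (of_bool (p = a) * t r q b - of_bool (q = a) * t r p b)" for p q r
  proof -
    have P_alt: "P p q r = (\<Sum>k\<in>UNIV. (\<Sum>m\<in>UNIV. t p a m * t q m k) * t r k b)" for p q r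
      unfolding P_def by (subst sum.swap) (simp add: sum_distrib_right)
    have "P p q r - P q p r =
      (\<Sum>k\<in>UNIV. ((\<Sum>m\<in>UNIV. t p a m * t q m k) - (\<Sum>m\<in>UNIV. t q a m * t p m k)) * t r k b)"
      unfolding P_alt by (simp only: sum_subtractf left_diff_distrib)
    also have "\<dots> = (\<Sum>k\<in>UNIV. - curv p q * (of_bool (p = a) * (of_bool (q = k) * t r k b)
        - of_bool (q = a) * (of_bool (p = k) * t r k b)))"
      unfolding commutator by (simp add: algebra_simps)
    also have "\<dots> = - curv p q * (of_bool (p = a) * t r q b - of_bool (q = a) * t r p b)"
      by (simp only: sum_distrib_left[symmetric] sum_subtractf sum_delta)
    finally show ?thesis .
  qed
  have right: "P r p q - P r q p = - curv p q * (t r a p * of_bool (q = b) - t r a q * of_bool (p = b))" for p q r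
  proof -
    have "P r p q - P r q p =
      (\<Sum>m\<in>UNIV. t r a m * ((\<Sum>k\<in>UNIV. t p m k * t q k b) - (\<Sum>k\<in>UNIV. t q m k * t p k b)))"
      unfolding P_def by (simp only: sum_distrib_left sum_subtractf right_diff_distrib mult.assoc)
    also have "\<dots> = (\<Sum>m\<in>UNIV. - curv p q * ((of_bool (p = m) * t r a m) * of_bool (q = b)
        - (of_bool (q = m) * t r a m) * of_bool (p = b)))"
      unfolding commutator by (simp add: algebra_simps)
    also have "\<dots> = - curv p q * (t r a p * of_bool (q = b) - t r a q * of_bool (p = b))"
      by (simp only: sum_distrib_left[symmetric] sum_distrib_right[symmetric] sum_subtractf sum_delta)
    finally show ?thesis .
  qed
  have "curv p q * (of_bool (p = a) * t r q b - of_bool (q = a) * t r p b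
     - t r a p * of_bool (q = b) + t r a q * of_bool (p = b)) =
     (P r p q - P r q p) - (P p q r - P q p r)" for p q r
    unfolding left right by (simp only: distrib_left right_diff_distrib)
  thus ?thesis by simp
qed

text \<open>The \<open>(i, i)\<close> entry of the Jacobi identity for \<open>i, j, k\<close>; the
  parts of \<open>curv\<close> that come from \<open>e\<close> cancel.\<close>

lemma off_diagonal:
  assumes "i \<noteq> j" "i \<noteq> k" "j \<noteq> k"
  shows "t i j k * s i * (s j - s k) = 0"
proof -
  have "t k j i * (curv i j - curv k i) = 0"
  proof -
    have "t k i j = t k j i" "t j k i = t k j i" "t j i k = t k j i" by (metis t12 t23)+
    thus ?thesis using bianchi[of i j i k i] assms by (simp add: right_diff_distrib mult.commute)
  qed
  moreover have "t k j i = t i j k" by (metis t12 t23)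
  ultimately have "t i j k * (e i * (e j - e k) + s i * (s j - s k)) = 0"
    by (simp add: curv_def algebra_simps)
  moreover have "t i j k * e i * e j = t i j k" "t i j k * e i * e k = t i j k"
    by (simp_all add: mult.commute[of _ "e _"])
  ultimately show ?thesis by algebra
qed

text \<open>The \<open>(l, k)\<close> entry of the Jacobi identity for \<open>i, l, j\<close>. It
  lets an index outside the triple supply the nonzero \<open>s l\<close> when \<open>s k\<close>
  vanishes.\<close>

lemma off_diagonal_outer:
  assumes "i \<noteq> j" "i \<noteq> k" "j \<noteq> k" "i \<noteq> l" "j \<noteq> l" "k \<noteq> l"
  shows "t i j k * s l * (s i - s j) = 0"
proof -
  have "t j i k = t i j k" by (rule t12)
  hence "t i j k * curv l j - t i j k * curv l i = 0"
    using bianchi[of i l l j k] assms curv_sym[of i l] by (simp add: algebra_simps)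
  hence "e l * t i j k + s l * s j * t i j k - (e l * t i j k + s l * s i * t i j k) = 0"
    by (simp only: curv_mult[OF et(1)] curv_mult[OF et(2)])
  thus ?thesis by algebra
qed

text \<open>The \<open>(p, q)\<close> entry of the Jacobi identity. It says that, for fixed
  \<open>r\<close>, the ratio of \<open>(s p - s r) * t r p p\<close> to \<open>s p\<close> is the
  same for all \<open>p\<close>; this common ratio becomes the multiplier
  \<open>v r\<close>.\<close>

lemma diagonal:
  assumes "p \<noteq> q" "q \<noteq> r" "p \<noteq> r"
  shows "s q * (s p - s r) * t r p p = s p * (s q - s r) * t r q q"
proof -
  have "t r p p * (curv q r - curv p q) + t r q q * (curv p q - curv r p) = 0"
  proof -
    have "t p p r = t r p p" "t q r q = t r q q" by (metis t12 t23)+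
    thus ?thesis using bianchi[of p q p r q] assms by (simp add: algebra_simps)
  qed
  hence "t r p p * curv q r - t r p p * curv q p + t r q q * curv p q - t r q q * curv p r = 0"
    by (simp only: curv_sym[of q p] curv_sym[of r p] right_diff_distrib)
  hence "e q * t r p p + s q * s r * t r p p - (e q * t r p p + s q * s p * t r p p)
    + (e p * t r q q + s p * s q * t r q q) - (e p * t r q q + s p * s r * t r q q) = 0"
    by (simp only: curv_mult[OF et(1)] curv_mult[OF et(2)])
  thus ?thesis by argo
qed

end

section \<open>Commuting multiplication operators and their joint eigenvector\<close>

context almost_flat_tensor begin

text \<open>The conclusion is the commutation condition for the extended multiplications. Any
  \<open>l\<close> different from \<open>i\<close> with \<open>s l\<close> nonzero determines
  \<open>v i\<close>, and \<open>diagonal\<close> makes the choice of \<open>l\<close> irrelevant.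
  For distinct \<open>i, j, k\<close> the right-hand side is zero and the off-diagonal identities
  apply.\<close>

lemma diagonal_multipliers:
  assumes "\<not> (\<exists>i. s i \<noteq> 0 \<and> (\<forall>j. j \<noteq> i \<longrightarrow> s j = 0))"
  obtains v where "\<And>i j k. (s j - s i) * t i j k =
    of_bool (j = k) * s j * v i - of_bool (i = k) * s i * v j"
proof -
  have "\<exists>x. \<forall>j. j \<noteq> i \<longrightarrow> (s j - s i) * t i j j = s j * x" for i
  proof (cases "\<exists>l. l \<noteq> i \<and> s l \<noteq> 0")
    case True
    then obtain l where l: "l \<noteq> i" "s l \<noteq> 0" by blast
    have "(s j - s i) * t i j j = s j * ((s l - s i) * t i l l / s l)" if "j \<noteq> i" for j
    proof (cases "j = l")
      case False
      with diagonal[of j l i] that l have "s l * ((s j - s i) * t i j j) = s j * ((s l - s i) * t i l l)"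
        by (simp add: mult.assoc)
      then show ?thesis using l by (simp add: field_simps)
    qed (use l in simp)
    then show ?thesis by blast
  next
    case False
    \<comment> \<open>All other entries of \<open>s\<close> vanish here, so a nonzero
      \<open>s i\<close> would be the excluded case; with \<open>s = 0\<close> any multiplier
      works.\<close>
    then have "s i = 0" using assms by blast
    then show ?thesis using False by auto
  qed
  then obtain v where v: "\<And>i j. j \<noteq> i \<Longrightarrow> (s j - s i) * t i j j = s j * v i"
    by metis
  have "(s j - s i) * t i j k = of_bool (j = k) * s j * v i - of_bool (i = k) * s i * v j" for i j k
  proof (cases "i = j \<or> j = k \<or> i = k")
    case True
    then show ?thesis
    proof (elim disjE)
      assume "i = k"
      have "t k j k = t j k k" by (metis t12 t23)
      with \<open>i = k\<close> show ?thesis using v[of k j] v[of j k] by (cases "j = k") (simp_all add: left_diff_distrib)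
    qed (use v[of k i] v[of j i] in \<open>cases "i = j"; simp add: left_diff_distrib\<close>)+
  next
    case False
    show ?thesis
    proof (cases "\<exists>l. l \<noteq> i \<and> l \<noteq> j \<and> s l \<noteq> 0")
      case True
      then obtain l where l: "l \<noteq> i" "l \<noteq> j" "s l \<noteq> 0" by blast
      have "t k i j = t i j k" by (metis t12 t23)
      then have "t i j k * s l * (s i - s j) = 0"
        using off_diagonal[of k i j] off_diagonal_outer[of i j k l] False l by (cases "l = k") auto
      then show ?thesis using l False by auto
    next
      \<comment> \<open>Only \<open>s i\<close> and \<open>s j\<close> can be nonzero, and by the
        assumption not exactly one of them is. If both are, \<open>off_diagonal\<close> with
        \<open>s k = 0\<close> kills \<open>t i j k\<close>.\<close>
      case all0: False
      then have "s i = 0 \<longleftrightarrow> s j = 0" using assms by metis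
      moreover have "s k = 0" using all0 False by metis
      ultimately have "s i = 0 \<and> s j = 0 \<or> t i j k = 0"
        using off_diagonal[of i j k] False by auto
      then show ?thesis using False by auto
    qed
  qed
  then show thesis by (rule that)
qed

text \<open>The flat extension: \<open>mult_op v i\<close> is multiplication by \<open>y\<^sub>i\<close> in the quotient algebra with basis
  \<open>1, (y\<^sub>j), n\<close>, the multiplier \<open>v i\<close> being the one entry not determined by the quartic.\<close>

definition mult_op :: "('n \<Rightarrow> real) \<Rightarrow> 'n \<Rightarrow> real \<times> (real ^ 'n) \<times> real \<Rightarrow> real \<times> (real ^ 'n) \<times> real" where
  "mult_op v i = (\<lambda>(a, x, b). (e i * x $ i,
     (\<chi> j. of_bool (i = j) * (e i * a + s i * b) + (\<Sum>k\<in>UNIV. t i j k * x $ k)),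
     s i * x $ i + v i * b))"

lemma linear_mult_op: "linear (mult_op v i)"
  by (rule linearI)
    (auto simp: mult_op_def vec_eq_iff algebra_simps sum.distrib sum_distrib_left)

lemma self_adjoint_mult_op: "mult_op v i p \<bullet> q = p \<bullet> mult_op v i q"
proof -
  obtain a x b where p: "p = (a, x, b)" by (cases p) auto
  obtain a' x' b' where q: "q = (a', x', b')" by (cases q) auto
  have "(\<Sum>j\<in>UNIV. (\<Sum>k\<in>UNIV. t i j k * x $ k) * x' $ j) = (\<Sum>j\<in>UNIV. x $ j * (\<Sum>k\<in>UNIV. t i j k * x' $ k))"
    unfolding sum_distrib_left sum_distrib_right
    by (subst sum.swap) (intro sum.cong refl, simp add: t23[of i] mult_ac)
  moreover have "(\<chi> j. of_bool (i = j) * c + f j) \<bullet> y = c * y $ i + (\<Sum>j\<in>UNIV. f j * y $ j)" for c f and y :: "real ^ 'n"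
    using sum_delta[of i "\<lambda>j. c * y $ j"]
    by (simp add: inner_vec_def distrib_right sum.distrib mult.assoc)
  moreover from this have "y \<bullet> (\<chi> j. of_bool (i = j) * c + f j) = c * y $ i + (\<Sum>j\<in>UNIV. y $ j * f j)" for c f and y :: "real ^ 'n"
    by (simp add: inner_commute mult.commute)
  ultimately show ?thesis
    unfolding p q by (simp add: mult_op_def) (simp add: distrib_left distrib_right mult_ac)
qed

text \<open>Compare coordinates. The first agrees by symmetry of \<open>t\<close>, and the last by
  the hypothesis on \<open>v\<close>. In the middle one, the terms in \<open>x\<close> cancel by
  \<open>commutator\<close>, those in \<open>b\<close> by the hypothesis on \<open>v\<close>, and
  those in \<open>a\<close> by symmetry again.\<close>

lemma commute_mult_op:
  assumes v: "\<And>i j k. (s j - s i) * t i j k = of_bool (j = k) * s j * v i - of_bool (i = k) * s i * v j"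
  shows "mult_op v i (mult_op v j p) = mult_op v j (mult_op v i p)"
proof (cases "i = j")
  case ij: False
  obtain a x b where p: "p = (a, x, b)" by (cases p) auto
  have d: "(\<Sum>k\<in>UNIV. t i l k * (of_bool (j = k) * c)) = t i l j * c" for i l j c
    using sum_delta[of j "\<lambda>k. t i l k * c"] by (simp add: mult_ac)
  have 1: "e i * (\<Sum>k\<in>UNIV. t j i k * x $ k) = e j * (\<Sum>k\<in>UNIV. t i j k * x $ k)"
    unfolding sum_distrib_left t12[of j i] by (intro sum.cong refl) (simp only: mult.assoc[symmetric] et)
  have 2: "e i * t j l i = t i j l" "s i * t j l i = s i * t i j l" for i j l
    using et(3)[of i j l] t12 t23 by metis+
  have 3: "s i * (\<Sum>k\<in>UNIV. t j i k * x $ k) + v i * (s j * x $ j) =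
    s j * (\<Sum>k\<in>UNIV. t i j k * x $ k) + v j * (s i * x $ i)"
  proof -
    have "(\<Sum>k\<in>UNIV. ((s j - s i) * t i j k) * x $ k) = s j * v i * x $ j - s i * v j * x $ i"
      unfolding v using sum_delta[of j "\<lambda>k. s j * v i * x $ k"] sum_delta[of i "\<lambda>k. s i * v j * x $ k"]
      by (simp add: left_diff_distrib sum_subtractf mult.assoc)
    hence "(s j - s i) * (\<Sum>k\<in>UNIV. t i j k * x $ k) = s j * v i * x $ j - s i * v j * x $ i"
      by (simp only: sum_distrib_left mult.assoc)
    thus ?thesis unfolding t12[of j i] by algebra
  qed
  have 4: "of_bool (i = l) * (e i * (e j * x $ j) + s i * (s j * x $ j + v j * b)) +
      (\<Sum>k\<in>UNIV. t i l k * (of_bool (j = k) * (e j * a + s j * b) + (\<Sum>m\<in>UNIV. t j k m * x $ m))) =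
     of_bool (j = l) * (e j * (e i * x $ i) + s j * (s i * x $ i + v i * b)) +
      (\<Sum>k\<in>UNIV. t j l k * (of_bool (i = k) * (e i * a + s i * b) + (\<Sum>m\<in>UNIV. t i k m * x $ m)))" for l
  proof -
    have tt: "(\<Sum>k\<in>UNIV. t i l k * (\<Sum>m\<in>UNIV. t j k m * x $ m)) =
       (\<Sum>m\<in>UNIV. (\<Sum>k\<in>UNIV. t i l k * t j k m) * x $ m)" for i j
      unfolding sum_distrib_left sum_distrib_right by (subst sum.swap) (simp add: mult.assoc)
    have "(\<Sum>m\<in>UNIV. ((\<Sum>k\<in>UNIV. t i l k * t j k m) - (\<Sum>k\<in>UNIV. t j l k * t i k m)) * x $ m) =
       (\<Sum>m\<in>UNIV. of_bool (i = m) * (of_bool (j = l) * curv i j * x $ m) - of_bool (j = m) * (of_bool (i = l) * curv i j * x $ m))"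
      unfolding commutator by (intro sum.cong refl) (simp add: algebra_simps)
    also have "\<dots> = of_bool (j = l) * curv i j * x $ i - of_bool (i = l) * curv i j * x $ j"
      unfolding sum_subtractf sum_delta ..
    finally have A: "(\<Sum>k\<in>UNIV. t i l k * (\<Sum>m\<in>UNIV. t j k m * x $ m)) - (\<Sum>k\<in>UNIV. t j l k * (\<Sum>m\<in>UNIV. t i k m * x $ m)) =
      of_bool (j = l) * curv i j * x $ i - of_bool (i = l) * curv i j * x $ j"
      unfolding tt by (simp add: left_diff_distrib sum_subtractf)
    have "t i l j * (e j * a + s j * b) - t j l i * (e i * a + s i * b) = ((s j - s i) * t i j l) * b"
    proof -
      have "t i l j = t i j l" "t j l i = t i j l" by (metis t12 t23)+
      moreover have "t i j l * (e k * a + s k * b) = e k * t i j l * a + s k * t i j l * b" for k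
        by (simp only: distrib_left mult_ac)
      ultimately show ?thesis by (simp add: left_diff_distrib)
    qed
    also have "\<dots> = of_bool (j = l) * s j * v i * b - of_bool (i = l) * s i * v j * b"
      unfolding v by (simp add: left_diff_distrib)
    finally have B: "t i l j * (e j * a + s j * b) - t j l i * (e i * a + s i * b) =
      of_bool (j = l) * s j * v i * b - of_bool (i = l) * s i * v j * b" .
    show ?thesis
      using A B unfolding distrib_left[of "t _ _ _" "of_bool _ * _"] sum.distrib d curv_def
      by (simp add: algebra_simps)
  qed
  have 3: "s i * (\<Sum>k\<in>UNIV. t j i k * x $ k) + v i * (s j * x $ j + v j * b) =
    s j * (\<Sum>k\<in>UNIV. t i j k * x $ k) + v j * (s i * x $ i + v i * b)"
    using 3 by algebra
  show ?thesis
    unfolding p mult_op_def using ij 1 3 4 by (simp add: vec_eq_iff del: distrib_left)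
qed simp

text \<open>The joint eigenvalues of the multiplication operators are the coordinates
  \<open>z i\<close>. The displayed equation is the middle coordinate of the eigenvalue equation,
  divided by the first entry of the eigenvector; \<open>c\<close> is the last entry after this
  scaling.\<close>

theorem evaluation_point:
  assumes "\<not> (\<exists>i. s i \<noteq> 0 \<and> (\<forall>j. j \<noteq> i \<longrightarrow> s j = 0))"
  obtains z c where "\<And>i j. z i * z j = of_bool (i = j) * (e i + c * s i) + (\<Sum>k\<in>UNIV. t i j k * z k)"
    and "\<And>i. e i = 0 \<Longrightarrow> z i = 0"
proof -
  obtain v where v: "\<And>i j k. (s j - s i) * t i j k =
      of_bool (j = k) * s j * v i - of_bool (i = k) * s i * v j"
    using diagonal_multipliers[OF assms] by blast
  \<comment> \<open>\<open>C\<close> drops the padded coordinates, and also the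
    \<open>n\<close>-direction when \<open>s = 0\<close>. Without this the eigenvector could be
    something like \<open>(0, 0, 1)\<close>, which carries no point.\<close>
  define C where "C = {(a :: real, x :: real ^ 'n, b :: real). (\<forall>i. e i = 0 \<longrightarrow> x $ i = 0) \<and> ((\<forall>i. s i = 0) \<longrightarrow> b = 0)}"
  have "subspace C" unfolding C_def subspace_def by (auto simp: zero_prod_def)
  moreover have "(1, 0, 0) \<in> C" by (simp add: C_def)
  hence "C \<noteq> {0}" by (auto simp: zero_prod_def)
  moreover have "mult_op v i p \<in> C" if "p \<in> C" for i p
  proof -
    have "t i j k = 0" if "e j = 0" for j k using t0[OF that, of i k] by (simp add: t12[of i j])
    thus ?thesis using \<open>p \<in> C\<close> s0[of i] by (auto simp: C_def mult_op_def)
  qed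
  ultimately obtain p where p: "p \<in> C" "p \<noteq> 0" "\<And>i. \<exists>c. mult_op v i p = c *\<^sub>R p"
    using joint_eigenvector[where N = "mult_op v" and I = UNIV and C = C]
      linear_mult_op self_adjoint_mult_op commute_mult_op[OF v] by auto
  obtain a x b where [simp]: "p = (a, x, b)" by (cases p) auto
  from p(3) obtain c where c: "\<And>i. mult_op v i p = c i *\<^sub>R p" by metis
  have c1: "e i * x $ i = c i * a" for i
    using c[of i] by (simp add: mult_op_def)
  have c2: "of_bool (i = j) * (e i * a + s i * b) + (\<Sum>k\<in>UNIV. t i j k * x $ k) = c i * x $ j" for i j
    using c[of i] by (simp add: mult_op_def vec_eq_iff)
  have x0: "e i * x $ i = x $ i" for i
    using e01[of i] p(1) by (auto simp: C_def)
  \<comment> \<open>If the first entry is 0, the first coordinates of the eigenvalue equations give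
    \<open>x = 0\<close>, the middle ones then \<open>s i * b = 0\<close>, and membership in
    \<open>C\<close> leaves only the zero vector.\<close>
  have "a \<noteq> 0"
  proof
    assume "a = 0"
    hence "x = 0" using c1 x0 by (simp add: vec_eq_iff)
    hence "s i * b = 0" for i using c2[of i i] \<open>a = 0\<close> by simp
    hence "b = 0" using p(1) by (auto simp: C_def)
    thus False using p(2) \<open>a = 0\<close> \<open>x = 0\<close> by (simp add: zero_prod_def)
  qed
  have ci: "c i = x $ i / a" for i
    using c1[of i] x0[of i] \<open>a \<noteq> 0\<close> by (simp add: field_simps)
  show thesis
  proof (rule that[of c "b / a"])
    show "e i = 0 \<Longrightarrow> c i = 0" for i using p(1) by (simp add: ci C_def)
    fix i j
    have "(\<Sum>k\<in>UNIV. t i j k * c k) = (\<Sum>k\<in>UNIV. t i j k * x $ k) / a"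
      by (simp add: ci sum_divide_distrib)
    thus "c i * c j = of_bool (i = j) * (e i + b / a * s i) + (\<Sum>k\<in>UNIV. t i j k * c k)"
      using c2[of i j] \<open>a \<noteq> 0\<close> by (simp add: ci[of j] field_simps)
  qed
qed

end

subsection \<open>Positive semidefinite quartic forms\<close>

lemma padded_enumeration:
  fixes B :: "'e::zero set"
  assumes "finite B" "card B \<le> CARD('n::finite)"
  obtains y :: "'n::finite \<Rightarrow> 'e" and J where "bij_betw y J B" "\<And>i. i \<notin> J \<Longrightarrow> y i = 0"
proof -
  obtain f :: "'e \<Rightarrow> 'n" where f: "inj_on f B"
    using card_le_inj[OF assms(1) finite assms(2)] by blast
  show thesis
  proof (rule that)
    show "bij_betw (\<lambda>i. if i \<in> f ` B then inv_into B f i else 0) (f ` B) B"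
      using bij_betw_inv_into[OF inj_on_imp_bij_betw[OF f]] by (rule bij_betw_cong[THEN iffD1, rotated]) simp
  qed simp
qed

text \<open>A model of multiplication of linear forms (\<open>m\<close>) and of the pairing of
  quadratic forms through the functional (\<open>b\<close>). Commutativity and associativity of
  polynomial multiplication survive only as \<open>m_sym\<close> and \<open>swap\<close>.\<close>

locale psd_quartic =
  fixes m :: "'e::euclidean_space \<Rightarrow> 'e \<Rightarrow> 'v::real_vector" and b :: "'v \<Rightarrow> 'v \<Rightarrow> real"
  assumes bil_m: "bilinear m" and m_sym: "m x y = m y x"
    and bil_b: "bilinear b" and b_sym: "b f g = b g f"
    and swap: "b (m x y) (m z w) = b (m x z) (m y w)"
    and psd: "f \<in> span (range (\<lambda>(x, y). m x y)) \<Longrightarrow> 0 \<le> b f f"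
begin

definition H where "H = span (range (\<lambda>(x, y). m x y))"

lemma m_in_H [simp]: "m x y \<in> H"
  unfolding H_def by (rule span_base) auto

lemma subspace_H: "subspace H" by (simp add: H_def)

lemma psd_H: "f \<in> H \<Longrightarrow> 0 \<le> b f f"
  unfolding H_def by (rule psd)

lemma H_null: "b f f = 0 \<Longrightarrow> f \<in> H \<Longrightarrow> g \<in> H \<Longrightarrow> b f g = 0"
  by (rule psd_bilinear_null[OF bil_b b_sym subspace_H psd_H])

lemmas m_lin = bilinear_ladd[OF bil_m] bilinear_radd[OF bil_m] bilinear_lmul[OF bil_m]
  bilinear_rmul[OF bil_m] bilinear_lzero[OF bil_m] bilinear_rzero[OF bil_m]
lemmas b_lin = bilinear_ladd[OF bil_b] bilinear_radd[OF bil_b] bilinear_lmul[OF bil_b]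
  bilinear_rmul[OF bil_b] bilinear_lzero[OF bil_b] bilinear_rzero[OF bil_b]

lemma m_sum: "m x (\<Sum>i\<in>I. g i) = (\<Sum>i\<in>I. m x (g i))"
  using bil_m by (simp add: bilinear_def linear_sum)

lemma b_sum: "b f (\<Sum>i\<in>I. g i) = (\<Sum>i\<in>I. b f (g i))" "b (\<Sum>i\<in>I. g i) f = (\<Sum>i\<in>I. b (g i) f)"
  using bil_b linear_sum[of "b f"] linear_sum[of "\<lambda>x. b x f"] by (simp_all add: bilinear_def)

definition N where "N = {x. b (m x x) (m x x) = 0}"

definition ker where "ker a = {x. \<forall>f\<in>H. b (m a x) f = 0}"

text \<open>By \<open>swap\<close> the right-hand side is the square length of \<open>m a x\<close>,
  and positivity turns zero length into orthogonality to all of \<open>H\<close>. The criterion is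
  symmetric in \<open>a\<close> and \<open>x\<close>.\<close>

lemma ker_iff: "x \<in> ker a \<longleftrightarrow> b (m a a) (m x x) = 0"
proof
  assume "b (m a a) (m x x) = 0"
  hence "b (m a x) (m a x) = 0" using swap[of a x a x] by simp
  thus "x \<in> ker a" using H_null by (simp add: ker_def)
next
  assume "x \<in> ker a"
  hence "b (m a x) (m a x) = 0" by (simp add: ker_def)
  thus "b (m a a) (m x x) = 0" using swap[of a x a x] by simp
qed

text \<open>If the square of \<open>x\<close> is null, it is orthogonal to the square of every
  \<open>y\<close>; by the symmetric criterion \<open>ker_iff\<close> this puts \<open>y\<close>
  into \<open>ker x\<close>.\<close>

lemma N_null: "x \<in> N \<Longrightarrow> f \<in> H \<Longrightarrow> b (m x y) f = 0"
proof -
  assume "x \<in> N" "f \<in> H"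
  hence "b (m x x) (m y y) = 0" using H_null[of "m x x" "m y y"] by (simp add: N_def)
  hence "y \<in> ker x" by (simp add: ker_iff)
  with \<open>f \<in> H\<close> show ?thesis by (simp add: ker_def)
qed

lemma N_subset_ker: "N \<subseteq> ker a"
  using N_null m_sym[of a] by (auto simp: ker_def)

lemma subspace_ker: "subspace (ker a)"
  by (auto simp: ker_def subspace_def m_lin b_lin)

text \<open>If \<open>x\<close> lies in \<open>ker a\<close> but not in \<open>N\<close>, then \<open>ker (a + x)\<close> is strictly smaller than \<open>ker a\<close>.\<close>

lemma generic_element: obtains a where "ker a = N"
proof -
  obtain a where a: "\<And>a'. dim (ker a) \<le> dim (ker a')"
    using ex_has_least_nat[of "\<lambda>_. True" _ "\<lambda>a. dim (ker a)"] by blast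
  have "x \<in> N" if x: "x \<in> ker a" for x
  proof (rule ccontr)
    assume "x \<notin> N"
    have "ker (a + x) \<subseteq> ker a"
    proof
      fix c assume c: "c \<in> ker (a + x)"
      have "b (m (a + x) c) (m a c) = 0" using c by (simp add: ker_def)
      moreover have "b (m x c) (m a c) = 0"
        using x swap[of a x c c] swap[of x c a c] m_sym[of a x] by (simp add: ker_def)
      ultimately have "b (m a c) (m a c) = 0" by (simp add: m_lin b_lin)
      thus "c \<in> ker a" using swap[of a c a c] by (simp add: ker_iff)
    qed
    moreover have "x \<notin> ker (a + x)"
    proof
      assume "x \<in> ker (a + x)"
      hence "b (m (a + x) x) (m x x) = 0" "b (m a x) (m x x) = 0"
        using x by (simp_all add: ker_def)
      thus False using \<open>x \<notin> N\<close> by (simp add: N_def m_lin b_lin)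
    qed
    ultimately have "ker (a + x) \<subset> ker a" using x by blast
    hence "dim (ker (a + x)) < dim (ker a)"
      using subspace_ker by (metis dim_psubset span_eq_iff)
    thus False using a[of "a + x"] by simp
  qed
  thus thesis using that N_subset_ker by blast
qed

end

text \<open>\<open>spanning\<close> states, tested through \<open>b\<close> only, that the multiples
  of \<open>a\<close> together with \<open>n\<close> fill \<open>H\<close> modulo the kernel. The
  value \<open>b n n = 0\<close> is allowed to cover the flat case, in which the multiples of
  \<open>a\<close> already suffice.\<close>

locale almost_flat_quartic = psd_quartic m b
  for m :: "'e::euclidean_space \<Rightarrow> 'e \<Rightarrow> 'v::real_vector" and b +
  fixes a :: 'e and n :: 'v
  assumes ker_a: "ker a = N" and a1: "b (m a a) (m a a) = 1"
    and n_H: "n \<in> H" and n_orth: "b n (m a x) = 0" and n01: "b n n = 0 \<or> b n n = 1"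
    and spanning: "f \<in> H \<Longrightarrow> \<exists>x c. \<forall>h\<in>H. b f h = b (m a x) h + c * b n h"
begin

text \<open>By \<open>swap\<close> this is \<open>b (m a x) (m a y)\<close>, hence semidefinite, and
  by \<open>ker_a\<close> its null vectors are exactly \<open>N\<close>.\<close>

definition g where "g x y = b (m a a) (m x y)"
definition s where "s x y = b n (m x y)"

lemma bil_g: "bilinear g" and bil_s: "bilinear s"
  unfolding g_def s_def bilinear_def linear_iff by (simp_all add: m_lin b_lin)

lemmas g_lin = bilinear_ladd[OF bil_g] bilinear_radd[OF bil_g] bilinear_lmul[OF bil_g] bilinear_rmul[OF bil_g]
lemma g_sym: "g x y = g y x" and s_sym: "s x y = s y x"
  by (simp_all add: g_def s_def m_sym[of x])

lemma g_nonneg: "0 \<le> g x x" 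
  using psd[of "m a x"] swap[of a a x x] m_in_H[of a x] by (simp add: g_def H_def)

lemma g_null: "x \<in> N \<Longrightarrow> g y x = 0"
  using N_null[of x "m a a" y] b_sym[of "m a a"] m_sym[of y] by (simp add: g_def)

lemma s_null: "x \<in> N \<Longrightarrow> s y x = 0"
  using N_null[of x n y] n_H b_sym[of n] m_sym[of y] by (simp add: s_def)

text \<open>Both forms are diagonalized on a complement of \<open>N\<close> in the
  \<open>g\<close>-complement of \<open>a\<close>, where \<open>g\<close> is positive definite. The
  set \<open>J\<close> marks the genuine vectors; the rest are zero padding.\<close>

lemma adapted_basis:
  assumes "DIM('e) \<le> CARD('n::finite)"
  obtains y :: "'n::finite \<Rightarrow> 'e" and J where
    "\<And>i. g a (y i) = 0" "\<And>i j. g (y i) (y j) = of_bool (i = j) * of_bool (i \<in> J)"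
    "\<And>i j. i \<noteq> j \<Longrightarrow> s (y i) (y j) = 0" "\<And>i. i \<notin> J \<Longrightarrow> y i = 0"
    "\<And>x. \<exists>u\<in>N. x = g a x *\<^sub>R a + (\<Sum>i\<in>UNIV. g (y i) x *\<^sub>R y i) + u"
proof -
  have subN: "subspace N" using subspace_ker[of a] ker_a by simp
  \<comment> \<open>The Euclidean inner product serves only to choose a complement of
    \<open>N\<close>.\<close>
  define Y where "Y = {x. g a x = 0 \<and> (\<forall>u\<in>N. u \<bullet> x = 0)}"
  have subY: "subspace Y"
    by (auto simp: Y_def subspace_def g_lin bilinear_rzero[OF bil_g] inner_add_right)
  have pos: "0 < g x x" if "x \<in> Y" "x \<noteq> 0" for x
  proof -
    have "x \<notin> N" using that by (auto simp: Y_def)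
    hence "g x x \<noteq> 0" using ker_iff[of x a] ker_a by (simp add: g_def)
    thus ?thesis using g_nonneg[of x] by simp
  qed
  from simultaneous_diagonalization[OF subY bil_g g_sym pos bil_s s_sym]
  obtain B where B: "finite B" "card B \<le> dim Y" "B \<subseteq> Y" "Y \<subseteq> span B"
    "\<forall>x\<in>B. g x x = 1" "\<forall>x\<in>B. \<forall>z\<in>B. x \<noteq> z \<longrightarrow> g x z = 0 \<and> s x z = 0"
    by blast
  have "card B \<le> CARD('n)" using B(2) dim_subset_UNIV[of Y] assms by linarith
  then obtain y :: "'n \<Rightarrow> 'e" and J where y: "bij_betw y J B" "\<And>i. i \<notin> J \<Longrightarrow> y i = 0"
    using padded_enumeration[OF B(1)] by blast
  have yB: "y i \<in> B" if "i \<in> J" for i using y(1) that by (auto simp: bij_betw_def)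
  have gy: "g (y i) (y j) = of_bool (i = j) * of_bool (i \<in> J)" for i j
    using y yB[of i] yB[of j] B(5,6) bilinear_lzero[OF bil_g] bilinear_rzero[OF bil_g]
    by (cases "i \<in> J"; cases "j \<in> J") (auto simp: bij_betw_def inj_on_eq_iff)
  show thesis
  proof (rule that[of y J])
    show ga: "g a (y i) = 0" for i
      using B(3) yB[of i] y(2)[of i] bilinear_rzero[OF bil_g] by (cases "i \<in> J") (auto simp: Y_def)
    show "g (y i) (y j) = of_bool (i = j) * of_bool (i \<in> J)" for i j by (rule gy)
    show "s (y i) (y j) = 0" if "i \<noteq> j" for i j
      using that y yB[of i] yB[of j] B(6) bilinear_lzero[OF bil_s] bilinear_rzero[OF bil_s]
      by (cases "i \<in> J"; cases "j \<in> J") (auto simp: bij_betw_def inj_on_eq_iff)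
    show "y i = 0" if "i \<notin> J" for i using y(2) that .
    show "\<exists>u\<in>N. x = g a x *\<^sub>R a + (\<Sum>i\<in>UNIV. g (y i) x *\<^sub>R y i) + u" for x
    proof -
      define x' where "x' = x - g a x *\<^sub>R a"
      have gax': "g a x' = 0"
        using a1 by (simp add: x'_def bilinear_rsub[OF bil_g] g_lin) (simp add: g_def)
      obtain u v where uv: "u \<in> span N" "\<And>w. w \<in> span N \<Longrightarrow> orthogonal v w" "x' = u + v"
        using orthogonal_subspace_decomp_exists[of N x'] by blast
      have u: "u \<in> N" using uv(1) subN span_eq_iff by blast
      have "g a v = 0" using gax' g_null[OF u] by (simp add: uv(3) g_lin)
      hence "v \<in> Y" using uv(2) by (auto simp: Y_def orthogonal_def inner_commute span_base)
      hence "v \<in> span B" using B(4) by blast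
      have "B \<subseteq> {z. z = (\<Sum>i\<in>UNIV. g (y i) z *\<^sub>R y i)}"
      proof
        fix z assume "z \<in> B"
        then obtain j where j: "j \<in> J" "z = y j" using y(1) by (auto simp: bij_betw_def)
        have "g (y i) (y j) *\<^sub>R y i = (if i = j then y i else 0)" for i using j by (simp add: gy)
        then show "z \<in> {z. z = (\<Sum>i\<in>UNIV. g (y i) z *\<^sub>R y i)}" using j by simp
      qed
      moreover have "subspace {z. z = (\<Sum>i\<in>UNIV. g (y i) z *\<^sub>R y i)}"
      proof -
        have "linear (\<lambda>z. (\<Sum>i\<in>UNIV. g (y i) z *\<^sub>R y i))"
          by (rule linearI) (simp_all add: g_lin scaleR_add_left sum.distrib scaleR_sum_right)
        hence "subspace {z. z - (\<Sum>i\<in>UNIV. g (y i) z *\<^sub>R y i) = 0}"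
          by (intro linear_subspace_kernel linear_compose_sub linear_id[unfolded id_def])
        thus ?thesis by simp
      qed
      ultimately have "span B \<subseteq> {z. z = (\<Sum>i\<in>UNIV. g (y i) z *\<^sub>R y i)}" by (rule span_minimal)
      with \<open>v \<in> span B\<close> have v: "v = (\<Sum>i\<in>UNIV. g (y i) v *\<^sub>R y i)" by blast
      have x: "x = g a x *\<^sub>R a + v + u" using uv(3) by (simp add: x'_def algebra_simps)
      have "g (y i) x = g (y i) v" for i
        using ga[of i] g_null[OF u] g_sym[of "y i" a] by (subst x) (simp add: g_lin)
      then show ?thesis using u v x by (intro bexI[of _ u]) simp_all
    qed
  qed
qed

end

section \<open>Evaluation points of almost flat quartics\<close>

context almost_flat_quartic begin

lemma b_m: "b (m a x) (m y z) = b (m a y) (m x z)"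
  by (rule swap)

text \<open>Applied below to the difference between a functional on products and a product of two
  linear functionals: it then suffices to check the pairs of basis vectors \<open>y\<close>.\<close>

lemma spanning_by_products:
  assumes span: "\<And>x. \<exists>u\<in>N. x = g a x *\<^sub>R a + (\<Sum>i\<in>UNIV. g (y i) x *\<^sub>R y i) + u"
    and R: "bilinear R" "\<And>x z. R x z = R z x" "\<And>x. R a x = 0" "\<And>u x. u \<in> N \<Longrightarrow> R u x = 0"
      "\<And>i j. R (y i) (y j) = (0 :: real)"
  shows "R x z = 0"
proof -
  have lin: "linear (\<lambda>x. R x z)" for z using R(1) by (simp add: bilinear_def)
  have expand: "R x z = (\<Sum>i\<in>UNIV. g (y i) x * R (y i) z)" for x z
  proof -
    obtain u where u: "u \<in> N" "x = g a x *\<^sub>R a + (\<Sum>i\<in>UNIV. g (y i) x *\<^sub>R y i) + u"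
      using span by blast
    show ?thesis
      by (subst u(2)) (use u(1) in \<open>simp add: linear_add[OF lin] linear_scale[OF lin] linear_sum[OF lin] R(3,4)\<close>)
  qed
  have "R (y i) z = 0" for i z
    using expand[of z "y i"] by (simp add: R(5) R(2)[of "y i"])
  then show ?thesis by (simp add: expand[of x])
qed

text \<open>Here \<open>z\<close> is evaluation at a real point on linear forms, and
  \<open>w\<close> represents the evaluation of quadratic forms at the same point through
  \<open>b\<close>.\<close>

theorem evaluation_functional:
  assumes "DIM('e) \<le> 4"
  obtains z :: "'e \<Rightarrow> real" and w where "linear z" "z \<noteq> (\<lambda>_. 0)" "w \<in> H" "\<And>x y. b w (m x y) = z x * z y"
proof -
  have "DIM('e) \<le> CARD(4)" using assms by simp
  then obtain y :: "4 \<Rightarrow> 'e" and J where ga: "\<And>i. g a (y i) = 0"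
    and gy: "\<And>i j. g (y i) (y j) = of_bool (i = j) * of_bool (i \<in> J)"
    and sy: "\<And>i j. i \<noteq> j \<Longrightarrow> s (y i) (y j) = 0" and y0: "\<And>i. i \<notin> J \<Longrightarrow> y i = 0"
    and span: "\<And>x. \<exists>u\<in>N. x = g a x *\<^sub>R a + (\<Sum>i\<in>UNIV. g (y i) x *\<^sub>R y i) + u"
    using adapted_basis by blast
  define e :: "4 \<Rightarrow> real" where "e i = of_bool (i \<in> J)" for i
  define \<sigma> where "\<sigma> i = s (y i) (y i)" for i
  define t where "t i j k = b (m a (y i)) (m (y j) (y k))" for i j k
  have gy': "g (y i) (y j) = of_bool (i = j) * e i" for i j by (simp add: gy e_def)
  have sy': "s (y i) (y j) = of_bool (i = j) * \<sigma> i" for i j using sy by (simp add: \<sigma>_def)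
  have sa: "s a x = 0" for x by (simp add: s_def n_orth)
  \<comment> \<open>Modulo the kernel, \<open>m a a\<close>, the nonzero \<open>m a (y k)\<close>
    and \<open>n\<close> (if not null) form an orthonormal basis. If \<open>b n n = 0\<close>, the
    last summand vanishes.\<close>
  have parseval: "b f h = b f (m a a) * b h (m a a) + (\<Sum>k\<in>UNIV. b f (m a (y k)) * b h (m a (y k))) + b f n * b h n"
    if f: "f \<in> H" and h: "h \<in> H" for f h
  proof -
    obtain x c where xc: "\<And>h. h \<in> H \<Longrightarrow> b f h = b (m a x) h + c * b n h" using spanning[OF f] by blast
    obtain u where u: "u \<in> N" "x = g a x *\<^sub>R a + (\<Sum>i\<in>UNIV. g (y i) x *\<^sub>R y i) + u" using span by blast
    have "b (m a x) h = g a x * b (m a a) h + (\<Sum>i\<in>UNIV. g (y i) x * b (m a (y i)) h) + b (m a u) h"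
      by (subst u(2)) (simp add: m_lin b_lin m_sum b_sum)
    moreover have "b (m a u) h = 0" using N_null[OF u(1) h, of a] by (simp add: m_sym)
    moreover have "b f (m a z) = g z x" for z
    proof -
      have "b f (m a z) = b (m a x) (m a z)" using xc[of "m a z"] n_orth by simp
      thus ?thesis using swap[of a x a z] by (simp add: g_def m_sym)
    qed
    moreover have "b f n * b h n = c * b n h"
      using xc[OF n_H] n01 n_orth[of x] b_sym[of "m a x" n] b_sym[of h n] H_null[OF _ n_H h] by auto
    ultimately show ?thesis using xc[OF h] by (auto simp: b_sym)
  qed
  interpret tensor: almost_flat_tensor t \<sigma> e
  proof
    show "t i j k = t j i k" for i j k unfolding t_def by (rule b_m)
    show "t i j k = t i k j" for i j k unfolding t_def by (simp add: m_sym)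
    show "e i = 0 \<or> e i = 1" for i by (simp add: e_def)
    show "\<sigma> i = 0" if "e i = 0" for i
      using that y0[of i] bilinear_lzero[OF bil_s] by (cases "i \<in> J") (simp_all add: e_def \<sigma>_def)
    show "t i j k = 0" if "e i = 0" for i j k
      using that y0[of i] by (cases "i \<in> J") (simp_all add: e_def t_def m_lin b_lin)
    have eq: "b (m (y i) (y j)) (m (y k) (y l)) = of_bool (i = j) * of_bool (k = l) * (e i * e k + \<sigma> i * \<sigma> k) +
       (\<Sum>p\<in>UNIV. t i j p * t k l p)" for i j k l
    proof -
      have "b (m (y i) (y j)) (m a a) = of_bool (i = j) * e i" for i j
        using gy'[of i j] by (simp add: g_def b_sym)
      moreover have "b (m (y i) (y j)) n = of_bool (i = j) * \<sigma> i" for i j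
        using sy'[of i j] by (simp add: s_def b_sym)
      moreover have "b (m (y i) (y j)) (m a (y p)) = t i j p" for i j p
        unfolding t_def by (metis swap m_sym b_sym)
      ultimately show ?thesis
        by (subst parseval) (simp_all add: distrib_left mult_ac)
    qed
    show "of_bool (i = j) * of_bool (k = l) * (e i * e k + \<sigma> i * \<sigma> k) + (\<Sum>m\<in>UNIV. t i j m * t k l m) =
       of_bool (i = k) * of_bool (j = l) * (e i * e j + \<sigma> i * \<sigma> j) + (\<Sum>m\<in>UNIV. t i k m * t j l m)" for i j k l
      unfolding eq[symmetric] by (rule swap)
  qed
  show thesis
  proof (cases "\<exists>i. \<sigma> i \<noteq> 0 \<and> (\<forall>j. j \<noteq> i \<longrightarrow> \<sigma> j = 0)")
    case True
    then obtain i where i: "\<sigma> i \<noteq> 0" "\<And>j. j \<noteq> i \<Longrightarrow> \<sigma> j = 0" by blast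
    \<comment> \<open>With only one nonzero entry the form \<open>s\<close> has rank one, so
      \<open>n\<close>, rescaled, is itself an evaluation. Its point is a zero of \<open>a\<close>,
      out of reach of the other case, where \<open>a\<close> takes the value 1.\<close>
    define R where "R x z = s x z - \<sigma> i * (g (y i) x * g (y i) z)" for x z
    have "e i = 1" using i(1) tensor.s0[of i] tensor.e01[of i] by auto
    have "R x z = 0" for x z
    proof (rule spanning_by_products[OF span])
      show "bilinear R"
        by (simp add: R_def bilinear_def linear_iff g_lin bilinear_ladd[OF bil_s] bilinear_radd[OF bil_s]
          bilinear_lmul[OF bil_s] bilinear_rmul[OF bil_s] algebra_simps)
      show "R x z = R z x" for x z by (simp add: R_def s_sym)
      show "R a x = 0" for x using ga[of i] by (simp add: R_def sa g_sym[of "y i"])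
      show "R u x = 0" if "u \<in> N" for u x
        using s_null[OF that, of x] g_null[OF that] by (simp add: R_def s_sym[of u])
      show "R (y j) (y k) = 0" for j k
        using i \<open>e i = 1\<close> by (cases "j = i"; cases "k = i") (auto simp: R_def gy' sy')
    qed
    then have "s x z = \<sigma> i * (g (y i) x * g (y i) z)" for x z by (simp add: R_def)
    then have "b (n /\<^sub>R \<sigma> i) (m x z) = g (y i) x * g (y i) z" for x z
      using i(1) by (simp add: b_lin s_def[symmetric])
    moreover have "linear (g (y i))" using bil_g by (simp add: bilinear_def)
    moreover have "g (y i) (y i) \<noteq> 0" by (simp add: gy' \<open>e i = 1\<close>)
    hence "g (y i) \<noteq> (\<lambda>_. 0)" by metis
    moreover have "n /\<^sub>R \<sigma> i \<in> H" using n_H subspace_H by (simp add: subspace_scale)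
    ultimately show thesis by (rule that[rotated 3])
  next
    case False
    then obtain z c where z: "\<And>i j. z i * z j = of_bool (i = j) * (e i + c * \<sigma> i) + (\<Sum>k\<in>UNIV. t i j k * z k)"
      and z0: "\<And>i. e i = 0 \<Longrightarrow> z i = 0"
      using tensor.evaluation_point by blast
    \<comment> \<open>The joint eigenvector, written in the basis \<open>m a a\<close>,
      \<open>m a (y k)\<close>, \<open>n\<close> with leading coefficient 1.\<close>
    define w where "w = m a a + (\<Sum>k\<in>UNIV. z k *\<^sub>R m a (y k)) + c *\<^sub>R n"
    have w: "w \<in> H" unfolding w_def
      using subspace_H n_H by (intro subspace_add subspace_sum subspace_scale) auto
    have bw: "b w h = b (m a a) h + (\<Sum>k\<in>UNIV. z k * b (m a (y k)) h) + c * b n h" for h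
      by (simp add: w_def b_lin b_sum)
    define \<zeta> where "\<zeta> x = b w (m a x)" for x
    have lin: "linear \<zeta>" by (simp add: \<zeta>_def linear_iff m_lin b_lin)
    have \<zeta>a: "\<zeta> a = 1"
    proof -
      have "b (m a (y k)) (m a a) = 0" for k using ga[of k] by (simp add: g_def b_sym)
      thus ?thesis using a1 by (simp add: \<zeta>_def bw n_orth)
    qed
    have \<zeta>y: "\<zeta> (y i) = z i" for i
    proof -
      have "b (m a (y k)) (m a (y i)) = of_bool (i = k) * e i" for k
        using gy'[of k i] swap[of a "y k" a "y i"] by (auto simp: g_def)
      hence "z k * b (m a (y k)) (m a (y i)) = of_bool (i = k) * z i" for k
        using z0[of i] tensor.e01[of i] by auto
      moreover have "b (m a a) (m a (y i)) = 0" using ga[of i] by (simp add: g_def)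
      ultimately show ?thesis using tensor.sum_delta[of i "\<lambda>_. z i"]
        by (simp only: \<zeta>_def bw n_orth)
    qed
    define R where "R x z = b w (m x z) - \<zeta> x * \<zeta> z" for x z
    have "R x z = 0" for x z
    proof (rule spanning_by_products[OF span])
      show "bilinear R"
        by (simp add: R_def bilinear_def linear_iff m_lin b_lin linear_add[OF lin] linear_scale[OF lin] algebra_simps)
      show "R x z = R z x" for x z by (simp add: R_def m_sym)
      show "R a x = 0" for x by (simp add: R_def \<zeta>a) (simp add: \<zeta>_def)
      show "R u x = 0" if "u \<in> N" for u x
        using N_null[OF that w, of x] N_null[OF that w, of a]
        by (simp add: R_def \<zeta>_def b_sym[of w] m_sym[of a])
      show "R (y i) (y j) = 0" for i j
      proof -
        have "b (m a (y k)) (m (y i) (y j)) = t i j k" for k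
          unfolding t_def by (metis swap m_sym b_sym)
        thus ?thesis using z[of i j] gy'[of i j] sy'[of i j]
          by (simp add: R_def \<zeta>y bw g_def[symmetric] s_def[symmetric] algebra_simps)
      qed
    qed
    moreover have "\<zeta> \<noteq> (\<lambda>_. 0)" using \<zeta>a by (metis zero_neq_one)
    ultimately show thesis using that[OF lin _ w] by (simp add: R_def)
  qed
qed

end

subsection \<open>Orthonormal systems modulo the kernel\<close>

locale psd_form =
  fixes V :: "'v::real_vector set" and b :: "'v \<Rightarrow> 'v \<Rightarrow> real"
  assumes subspace_V: "subspace V" and bil: "bilinear b" and sym: "b f g = b g f"
    and nonneg: "f \<in> V \<Longrightarrow> 0 \<le> b f f"
begin

definition null where "null = {f \<in> V. \<forall>g\<in>V. b f g = 0}"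

definition orthonormal where
  "orthonormal D \<longleftrightarrow> finite D \<and> D \<subseteq> V \<and> (\<forall>e\<in>D. \<forall>f\<in>D. b e f = of_bool (e = f))"

definition proj where "proj D f = (\<Sum>e\<in>D. b f e *\<^sub>R e)"

text \<open>An orthonormal basis of \<open>V\<close> modulo the null space; its cardinality is the
  rank of \<open>b\<close> by \<open>dim_dual\<close>.\<close>

definition parseval where "parseval D \<longleftrightarrow> orthonormal D \<and> (\<forall>f\<in>V. f - proj D f \<in> null)"

text \<open>The value 0 outside \<open>V\<close> matches the encoding of functionals in
  \<open>quadratic_form_rank\<close>.\<close>

definition dual where "dual f = (\<lambda>g. if g \<in> V then b f g else 0)"

lemmas lin = bilinear_ladd[OF bil] bilinear_radd[OF bil] bilinear_lmul[OF bil]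
  bilinear_rmul[OF bil] bilinear_lzero[OF bil] bilinear_rzero[OF bil] bilinear_lsub[OF bil] bilinear_rsub[OF bil]

lemma sum_left: "b (\<Sum>i\<in>I. g i) f = (\<Sum>i\<in>I. b (g i) f)"
  using bil linear_sum[of "\<lambda>x. b x f"] by (simp add: bilinear_def)

lemma subspace_null: "subspace null"
  using subspace_V by (auto simp: null_def subspace_def lin)

lemma nullI: "f \<in> V \<Longrightarrow> b f f = 0 \<Longrightarrow> f \<in> null"
  using psd_bilinear_null[OF bil sym subspace_V nonneg] by (auto simp: null_def)

lemma proj_in_V: "orthonormal D \<Longrightarrow> proj D f \<in> V"
  using subspace_V by (auto simp: orthonormal_def proj_def intro!: subspace_sum subspace_scale)

lemma b_proj: "b (proj D f) g = (\<Sum>e\<in>D. b f e * b e g)"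
  by (simp add: proj_def sum_left lin)

lemma b_proj_in:
  assumes "orthonormal D" "e \<in> D"
  shows "b (proj D f) e = b f e"
proof -
  have "b f x * b x e = (if x = e then b f e else 0)" if "x \<in> D" for x
    using assms that by (auto simp: orthonormal_def)
  hence "b (proj D f) e = (\<Sum>x\<in>D. if x = e then b f e else 0)"
    unfolding b_proj by (intro sum.cong refl)
  thus ?thesis using assms by (simp add: orthonormal_def)
qed

lemma parseval_expand:
  assumes "parseval D" "f \<in> V" "g \<in> V"
  shows "b f g = (\<Sum>e\<in>D. b f e * b e g)"
proof -
  have "b (f - proj D f) g = 0" using assms by (simp add: parseval_def null_def)
  thus ?thesis by (simp add: lin b_proj)
qed

text \<open>Pairing with \<open>e\<close> kills the null vectors and the other members of
  \<open>D\<close>, but not \<open>e\<close>. This yields that rank plus nullity is at most the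
  dimension.\<close>

lemma independent_orthonormal_Un:
  assumes "orthonormal D" "independent B" "B \<subseteq> null"
  shows "independent (D \<union> B)" "D \<inter> B = {}"
proof -
  have D: "finite D" "D \<subseteq> V" "\<And>e f. e \<in> D \<Longrightarrow> f \<in> D \<Longrightarrow> b e f = of_bool (e = f)"
    using assms(1) by (auto simp: orthonormal_def)
  have notin: "e \<notin> span (D' \<union> B)" if "e \<in> D" "D' \<subseteq> D - {e}" for e D'
  proof
    assume "e \<in> span (D' \<union> B)"
    moreover have "D' \<union> B \<subseteq> {x. b e x = 0}"
    proof
      fix x assume "x \<in> D' \<union> B"
      then show "x \<in> {x. b e x = 0}"
      proof
        assume "x \<in> D'"
        hence "x \<in> D" "e \<noteq> x" using that(2) by auto
        thus ?thesis using D(3)[OF that(1)] by simp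
      next
        assume "x \<in> B"
        hence "b x e = 0" using assms(3) D(2) that(1) by (auto simp: null_def)
        thus ?thesis by (simp add: sym[of e])
      qed
    qed
    moreover have "subspace {x. b e x = 0}" by (auto simp: subspace_def lin)
    ultimately have "b e e = 0" using span_minimal[of "D' \<union> B" "{x. b e x = 0}"] by auto
    with D(3)[OF that(1) that(1)] show False by simp
  qed
  show "D \<inter> B = {}" using notin[of _ "{}"] span_base by auto
  have "independent (D' \<union> B)" if "D' \<subseteq> D" for D'
    using finite_subset[OF that D(1)] that
  proof (induction D' rule: finite_induct)
    case (insert e D')
    have "D' \<subseteq> D - {e}" using insert.hyps insert.prems by auto
    then have "e \<notin> span (D' \<union> B)" using notin insert.prems by blast
    then show ?case using insert.IH insert.prems independent_insertI[of e "D' \<union> B"] by simp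
  qed (use assms in simp)
  thus "independent (D \<union> B)" by blast
qed

text \<open>A Gram-Schmidt step for a semidefinite form: a residual that is not null has positive
  length by \<open>nullI\<close>, so it can be normalized.\<close>

lemma orthonormal_extend:
  assumes "orthonormal D" "f \<in> V" "f - proj D f \<notin> null"
  obtains h where "orthonormal (insert h D)" "h \<notin> D"
proof -
  define f' where "f' = f - proj D f"
  have f': "f' \<in> V" using assms(1,2) subspace_V proj_in_V by (simp add: f'_def subspace_diff)
  have pos: "0 < b f' f'"
    using nonneg[OF f'] nullI[OF f'] assms(3) by (auto simp: f'_def[symmetric] less_le)
  have orth: "b f' e = 0" if "e \<in> D" for e
    using b_proj_in[OF assms(1) that] by (simp add: f'_def lin)
  define h where "h = f' /\<^sub>R sqrt (b f' f')"
  have hh: "b h h = 1" using pos by (simp add: h_def lin field_simps)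
  have hD: "b h e = 0" "b e h = 0" if "e \<in> D" for e
    using orth[OF that] sym[of e f'] by (simp_all add: h_def lin)
  have "h \<notin> D" using hh hD by force
  moreover have "h \<in> V" using f' subspace_V by (simp add: h_def subspace_scale)
  hence "orthonormal (insert h D)"
    using assms(1) hh hD \<open>h \<notin> D\<close> unfolding orthonormal_def by auto
  ultimately show thesis using that by blast
qed

text \<open>An orthonormal system of largest cardinality cannot be extended, so all its residuals
  are null.\<close>

lemma parseval_exists:
  assumes "finite S" "V \<subseteq> span S"
  obtains D where "parseval D"
proof -
  have bound: "card D \<le> card S" if "orthonormal D" for D
    using independent_span_bound[OF assms(1), of D] independent_orthonormal_Un(1)[OF that independent_empty] that assms(2)
    by (auto simp: orthonormal_def)
  have "orthonormal {}" by (simp add: orthonormal_def)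
  then obtain D where D: "orthonormal D" "\<And>D'. orthonormal D' \<Longrightarrow> card D' \<le> card D"
    using ex_has_greatest_nat[of orthonormal "{}" card "Suc (card S)"] bound by (metis le_imp_less_Suc)
  have "f - proj D f \<in> null" if f: "f \<in> V" for f
  proof (rule ccontr)
    assume "f - proj D f \<notin> null"
    then obtain h where "orthonormal (insert h D)" "h \<notin> D"
      using orthonormal_extend[OF D(1) f] by blast
    with D(2)[of "insert h D"] D(1) show False by (simp add: orthonormal_def)
  qed
  thus thesis using that D(1) by (auto simp: parseval_def)
qed

lemma linear_dual: "linear dual"
  by (rule linearI) (auto simp: dual_def lin fun_eq_iff scaleR_fun_def)

lemma independent_dual:
  assumes "orthonormal D"
  shows "independent (dual ` D)" "inj_on dual D"
proof -
  have D: "finite D" "\<And>e f. e \<in> D \<Longrightarrow> f \<in> D \<Longrightarrow> dual e f = of_bool (e = f)"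
    using assms by (auto simp: orthonormal_def dual_def)
  show inj: "inj_on dual D"
  proof
    fix x y assume "x \<in> D" "y \<in> D" "dual x = dual y"
    with D(2)[of x x] D(2)[of y x] show "x = y" by (cases "x = y") auto
  qed
  show "independent (dual ` D)"
  proof (rule independent_if_scalars_zero)
    fix u x assume sum0: "(\<Sum>x\<in>dual ` D. u x *\<^sub>R x) = 0" and "x \<in> dual ` D"
    then obtain e where e: "e \<in> D" "x = dual e" by blast
    have "(\<Sum>f\<in>D. u (dual f) *\<^sub>R dual f) = 0"
      using sum0 by (simp add: sum.reindex[OF inj] o_def)
    hence "(\<Sum>f\<in>D. u (dual f) *\<^sub>R dual f) e = 0" by simp
    moreover have "(\<Sum>f\<in>F. u (dual f) *\<^sub>R dual f) e = (\<Sum>f\<in>F. u (dual f) * dual f e)" for F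
      by (induction F rule: infinite_finite_induct) (simp_all add: scaleR_fun_def)
    moreover have "(\<Sum>f\<in>D. u (dual f) * dual f e) = (\<Sum>f\<in>D. if f = e then u x else 0)"
      using D(2) e by (intro sum.cong) auto
    ultimately show "u x = 0" using D(1) e(1) by simp
  qed (use D(1) in simp)
qed

lemma dual_in_span:
  assumes "parseval D" "f \<in> V"
  shows "dual f \<in> span (dual ` D)"
proof -
  have "dual (f - proj D f) = 0"
    using assms by (auto simp: parseval_def null_def dual_def)
  hence "dual f = dual (proj D f)" by (simp add: linear_diff[OF linear_dual])
  also have "\<dots> = (\<Sum>e\<in>D. b f e *\<^sub>R dual e)"
    by (simp add: proj_def linear_sum[OF linear_dual] linear_scale[OF linear_dual])
  also have "\<dots> \<in> span (dual ` D)" by (intro span_sum span_scale span_base imageI)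
  finally show ?thesis .
qed

lemma dim_dual:
  assumes "parseval D"
  shows "dim (dual ` V) = card D"
proof (rule dim_unique)
  have D: "orthonormal D" using assms by (simp add: parseval_def)
  show "dual ` D \<subseteq> dual ` V" using D by (auto simp: orthonormal_def)
  show "dual ` V \<subseteq> span (dual ` D)" using dual_in_span[OF assms] by auto
  show "independent (dual ` D)" "card (dual ` D) = card D"
    using independent_dual[OF D] by (auto simp: card_image)
qed

lemma orthonormal_card_le:
  assumes "parseval D" "orthonormal D'"
  shows "card D' \<le> card D"
proof -
  have "finite D" "D' \<subseteq> V" using assms by (auto simp: parseval_def orthonormal_def)
  have "card (dual ` D') \<le> card (dual ` D)"
    using independent_span_bound[of "dual ` D" "dual ` D'"] independent_dual(1)[OF assms(2)]
      dual_in_span[OF assms(1)] \<open>finite D\<close> \<open>D' \<subseteq> V\<close> by auto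
  thus ?thesis using independent_dual(2) assms by (simp add: card_image parseval_def)
qed

lemma card_parseval_le:
  assumes "parseval D" "finite S" "S \<subseteq> V" "\<And>f. f \<in> V \<Longrightarrow> \<exists>s\<in>span S. f - s \<in> null"
  shows "card D \<le> card S"
proof -
  have "dual ` V \<subseteq> span (dual ` S)"
  proof
    fix x assume "x \<in> dual ` V"
    then obtain f where f: "f \<in> V" "x = dual f" by blast
    then obtain s where s: "s \<in> span S" "f - s \<in> null" using assms(4) by blast
    have "dual (f - s) = 0" using s(2) by (auto simp: null_def dual_def)
    hence "dual f = dual s" by (simp add: linear_diff[OF linear_dual])
    with f s(1) show "x \<in> span (dual ` S)" by (simp add: linear_span_image[OF linear_dual])
  qed
  hence "dim (dual ` V) \<le> card (dual ` S)" using assms(2) by (intro dim_le_card) auto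
  thus ?thesis using dim_dual[OF assms(1)] card_image_le[OF assms(2), of dual] by linarith
qed

end

subsection \<open>Monomials and forms\<close>

lemma lookup_scaleR [simp]: "Poly_Mapping.lookup (c *\<^sub>R p) k = c *\<^sub>R Poly_Mapping.lookup p k"
proof -
  have "{k. c *\<^sub>R Poly_Mapping.lookup p k \<noteq> 0} \<subseteq> Poly_Mapping.keys p"
    by (auto simp: in_keys_iff)
  hence "finite {k. c *\<^sub>R Poly_Mapping.lookup p k \<noteq> 0}" by (rule finite_subset) simp
  thus ?thesis by (simp add: scaleR_poly_mapping_def)
qed

lemma scaleR_eq_single_mult: "c *\<^sub>R p = Poly_Mapping.single 0 c * p" for p :: real_mpoly
  by (rule poly_mapping_eqI) (simp add: mult_map_scale_conv_mult[symmetric] Poly_Mapping.map.rep_eq when_def)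

lemma mult_scaleR: "(c *\<^sub>R p) * q = c *\<^sub>R (p * q)" "p * (c *\<^sub>R q) = c *\<^sub>R (p * q)" for p q :: real_mpoly
  by (simp_all add: scaleR_eq_single_mult mult_ac)

lemma bilinear_times: "bilinear ((*) :: real_mpoly \<Rightarrow> real_mpoly \<Rightarrow> real_mpoly)"
  by (simp add: bilinear_def linear_iff mult_scaleR algebra_simps)

definition mons :: "nat \<Rightarrow> nat \<Rightarrow> (nat \<Rightarrow>\<^sub>0 nat) set" where
  "mons n d = {m. Poly_Mapping.keys m \<subseteq> {..<n} \<and> monom_degree m = d}"

abbreviation mon :: "(nat \<Rightarrow>\<^sub>0 nat) \<Rightarrow> real_mpoly" where "mon m \<equiv> Poly_Mapping.single m 1"

lemma mon_add: "mon (m + m') = mon m * mon m'" by (simp add: mult_single)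

lemma inj_mon: "inj mon" by (rule injI) (metis inj_single lookup_single_eq lookup_single_not_eq zero_neq_one)

lemma monom_degree_eq: "Poly_Mapping.keys m \<subseteq> {..<n} \<Longrightarrow> monom_degree m = (\<Sum>i<n. Poly_Mapping.lookup m i)"
  unfolding monom_degree_def by (intro sum.mono_neutral_left) (auto simp: in_keys_iff)

lemma mons_add: "m \<in> mons n d \<Longrightarrow> m' \<in> mons n d' \<Longrightarrow> m + m' \<in> mons n (d + d')"
proof -
  assume m: "m \<in> mons n d" "m' \<in> mons n d'"
  hence "Poly_Mapping.keys (m + m') \<subseteq> {..<n}" using keys_add[of m m'] by (auto simp: mons_def)
  thus ?thesis using m monom_degree_eq[of m n] monom_degree_eq[of m' n]
    by (simp add: mons_def monom_degree_eq[of "m + m'" n] lookup_add sum.distrib)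
qed

lemma single_in_mons: "i < n \<Longrightarrow> Poly_Mapping.single i 1 \<in> mons n 1"
  by (simp add: mons_def monom_degree_def)

lemma mons_Suc:
  assumes "m \<in> mons n (Suc d)"
  obtains i m' where "i < n" "m' \<in> mons n d" "m = Poly_Mapping.single i 1 + m'"
proof -
  have "m \<noteq> 0" using assms by (auto simp: mons_def monom_degree_def)
  then have "Poly_Mapping.keys m \<noteq> {}" by (simp add: poly_mapping_eq_iff fun_eq_iff in_keys_iff set_eq_iff)
  then obtain i where i: "i \<in> Poly_Mapping.keys m" by blast
  define m' where "m' = m - Poly_Mapping.single i 1"
  have m: "m = Poly_Mapping.single i 1 + m'"
    using i by (intro poly_mapping_eqI) (auto simp: m'_def lookup_add lookup_minus lookup_single when_def in_keys_iff)
  have keys: "Poly_Mapping.keys m' \<subseteq> {..<n}" "Poly_Mapping.keys m \<subseteq> {..<n}" "i < n"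
    using assms i by (auto simp: mons_def m'_def in_keys_iff lookup_minus subset_iff)
  have "monom_degree m = 1 + monom_degree m'"
    unfolding monom_degree_eq[OF keys(1)] monom_degree_eq[OF keys(2)]
    by (subst m) (use keys(3) in \<open>simp add: lookup_add sum.distrib lookup_single when_def\<close>)
  then show thesis using that[of i m'] m keys assms by (auto simp: mons_def)
qed

lemma mons_0: "mons n 0 = {0}"
  by (auto simp: mons_def monom_degree_def in_keys_iff intro!: poly_mapping_eqI)

text \<open>Stars and bars, through the lists of exponents.\<close>

lemma card_mons: "n > 0 \<Longrightarrow> finite (mons n d) \<and> card (mons n d) = (d + n - 1) choose d"
proof -
  assume "n > 0"
  define \<phi> :: "(nat \<Rightarrow>\<^sub>0 nat) \<Rightarrow> nat list" where "\<phi> m = map (Poly_Mapping.lookup m) [0..<n]" for m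
  have bij: "bij_betw \<phi> (mons n d) {l. length l = n \<and> sum_list l = d}"
    unfolding bij_betw_def
  proof
    show "inj_on \<phi> (mons n d)"
    proof
      fix m m' assume m: "m \<in> mons n d" "m' \<in> mons n d" "\<phi> m = \<phi> m'"
      show "m = m'"
      proof (rule poly_mapping_eqI)
        fix i show "Poly_Mapping.lookup m i = Poly_Mapping.lookup m' i"
        proof (cases "i < n")
          case True
          then show ?thesis using m(3) by (simp add: \<phi>_def)
        next
          case False
          then have "i \<notin> Poly_Mapping.keys m" "i \<notin> Poly_Mapping.keys m'" using m by (auto simp: mons_def)
          then show ?thesis by (simp add: in_keys_iff)
        qed
      qed
    qed
    show "\<phi> ` mons n d = {l. length l = n \<and> sum_list l = d}"
    proof (intro equalityI subsetI)
      fix l assume "l \<in> \<phi> ` mons n d"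
      then show "l \<in> {l. length l = n \<and> sum_list l = d}"
        by (auto simp: \<phi>_def mons_def monom_degree_eq interv_sum_list_conv_sum_set_nat atLeast0LessThan)
    next
      fix l assume l: "l \<in> {l. length l = n \<and> sum_list l = d}"
      define m where "m = (\<Sum>i<n. Poly_Mapping.single i (l ! i))"
      have lk: "Poly_Mapping.lookup m i = (if i < n then l ! i else 0)" for i
        by (simp add: m_def lookup_sum lookup_single when_def)
      have "\<phi> m = l" using l by (intro nth_equalityI) (auto simp: \<phi>_def lk)
      moreover have "m \<in> mons n d"
      proof -
        have k: "Poly_Mapping.keys m \<subseteq> {..<n}" by (auto simp: in_keys_iff lk split: if_splits)
        have "sum_list l = (\<Sum>i<n. l ! i)" using l by (simp add: sum_list_sum_nth atLeast0LessThan)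
        thus ?thesis using k l by (simp add: mons_def monom_degree_eq[OF k] lk)
      qed
      ultimately show "l \<in> \<phi> ` mons n d" by blast
    qed
  qed
  have "card {l::nat list. length l = n \<and> sum_list l = d} = (d + n - 1) choose d"
    by (rule card_length_sum_list)
  \<comment> \<open>An infinite set has \<open>card\<close> 0, so a nonzero count also proves
    finiteness.\<close>
  moreover have "(d + n - 1) choose d \<noteq> 0" using \<open>n > 0\<close> by simp
  ultimately have "card (mons n d) = (d + n - 1) choose d" "card (mons n d) \<noteq> 0"
    using bij_betw_same_card[OF bij] by simp_all
  thus ?thesis using card.infinite[of "mons n d"] by auto
qed

lemma poly_mapping_sum_keys:
  fixes p :: real_mpoly
  assumes "finite S" "Poly_Mapping.keys p \<subseteq> S"
  shows "p = (\<Sum>m\<in>S. Poly_Mapping.lookup p m *\<^sub>R mon m)"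
proof (rule poly_mapping_eqI)
  fix k
  have "Poly_Mapping.lookup p m * (1 when m = k) = (if m = k then Poly_Mapping.lookup p k else 0)" for m
    by (simp add: when_def)
  thus "Poly_Mapping.lookup p k = Poly_Mapping.lookup (\<Sum>m\<in>S. Poly_Mapping.lookup p m *\<^sub>R mon m) k"
    using assms by (auto simp: lookup_sum lookup_single in_keys_iff)
qed

lemma span_mon: "span (range mon) = UNIV"
proof -
  have "p \<in> span (range mon)" for p
    by (subst poly_mapping_sum_keys[OF finite_keys order_refl]) (intro span_sum span_scale span_base rangeI)
  thus ?thesis by blast
qed

lemma independent_mon: "independent (mon ` M)"
proof -
  have "mon m \<notin> span (mon ` M - {mon m})" for m
  proof
    assume "mon m \<in> span (mon ` M - {mon m})"
    moreover have "subspace {p :: real_mpoly. Poly_Mapping.lookup p m = 0}"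
      by (auto simp: subspace_def lookup_add)
    moreover have "mon ` M - {mon m} \<subseteq> {p. Poly_Mapping.lookup p m = 0}"
      by (auto simp: lookup_single when_def)
    ultimately have "mon m \<in> {p. Poly_Mapping.lookup p m = 0}" using span_minimal by blast
    thus False by simp
  qed
  thus ?thesis by (auto simp: dependent_def)
qed

lemma forms_eq_span: "forms n d = span (mon ` mons n d)"
proof
  show "forms n d \<subseteq> span (mon ` mons n d)"
  proof
    fix p assume "p \<in> forms n d"
    hence "Poly_Mapping.keys p \<subseteq> mons n d" by (auto simp: forms_def mons_def)
    thus "p \<in> span (mon ` mons n d)"
      by (subst poly_mapping_sum_keys[OF finite_keys order_refl]) (intro span_sum span_scale span_base, auto)
  qed
  have "subspace (forms n d)"
  proof -
    have "Poly_Mapping.keys (c *\<^sub>R p) \<subseteq> Poly_Mapping.keys p" for c and p :: real_mpoly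
      by (auto simp: in_keys_iff)
    hence "c *\<^sub>R p \<in> forms n d" if "p \<in> forms n d" for c p using that by (force simp: forms_def)
    moreover have "p + q \<in> forms n d" if "p \<in> forms n d" "q \<in> forms n d" for p q
      using that keys_add[of p q] by (force simp: forms_def)
    moreover have "0 \<in> forms n d" by (simp add: forms_def)
    ultimately show ?thesis unfolding subspace_def by blast
  qed
  moreover have "mon ` mons n d \<subseteq> forms n d" by (auto simp: forms_def mons_def)
  ultimately show "span (mon ` mons n d) \<subseteq> forms n d" by (simp add: span_minimal)
qed

lemma subspace_forms: "subspace (forms n d)" by (simp add: forms_eq_span)

lemma span_times:
  fixes f g :: real_mpoly
  assumes "f \<in> span A" "g \<in> span B" "\<And>x y. x \<in> A \<Longrightarrow> y \<in> B \<Longrightarrow> x * y \<in> span C"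
  shows "f * g \<in> span C"
proof -
  have 1: "x * g \<in> span C" if "x \<in> A" for x
    using assms(2)
  proof (induction rule: span_induct)
    case base show ?case by (auto simp: subspace_def distrib_left mult_scaleR span_zero span_add span_scale)
  qed (use that assms(3) in auto)
  show ?thesis using assms(1)
  proof (induction rule: span_induct)
    case base show ?case by (auto simp: subspace_def distrib_right mult_scaleR span_zero span_add span_scale)
  qed (use 1 in auto)
qed

lemma forms_mult: "f \<in> forms n d \<Longrightarrow> g \<in> forms n d' \<Longrightarrow> f * g \<in> forms n (d + d')"
  unfolding forms_eq_span by (rule span_times) (auto simp: mon_add[symmetric] intro!: span_base imageI mons_add)

text \<open>Extend the values on monomials linearly; both sides of the product rule are bilinear, so
  it need only be checked on monomials.\<close>

lemma evaluation_exists: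
  fixes z :: "nat \<Rightarrow> real"
  obtains ev :: "real_mpoly \<Rightarrow> real" where "linear ev" "\<And>f g. ev (f * g) = ev f * ev g"
    "\<And>i. ev (mon (Poly_Mapping.single i 1)) = z i"
proof -
  define v where "v m = (\<Prod>i\<in>Poly_Mapping.keys m. z i ^ Poly_Mapping.lookup m i)" for m :: "nat \<Rightarrow>\<^sub>0 nat"
  have v_eq: "v m = (\<Prod>i\<in>S. z i ^ Poly_Mapping.lookup m i)" if "finite S" "Poly_Mapping.keys m \<subseteq> S" for m S
    unfolding v_def using that by (intro prod.mono_neutral_left) (auto simp: in_keys_iff)
  have v_add: "v (m + m') = v m * v m'" for m m'
  proof -
    let ?S = "Poly_Mapping.keys m \<union> Poly_Mapping.keys m'"
    show ?thesis using keys_add[of m m']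
      by (simp add: v_eq[of ?S] lookup_add power_add prod.distrib)
  qed
  obtain ev :: "real_mpoly \<Rightarrow> real" where ev: "linear ev" "\<And>p. p \<in> range mon \<Longrightarrow> ev p = v (inv mon p)"
    using linear_independent_extend[OF independent_mon[of UNIV], of "\<lambda>p. v (inv mon p)"] by blast
  have ev_mon: "ev (mon m) = v m" for m using ev(2)[of "mon m"] by (simp add: inv_f_f[OF inj_mon])
  have "ev (f * g) = ev f * ev g" for f g
  proof (rule bilinear_eq[where S = UNIV and T = UNIV and B = "range mon" and C = "range mon"])
    show "bilinear (\<lambda>f g. ev (f * g))" "bilinear (\<lambda>f g. ev f * ev g)"
      by (simp_all add: bilinear_def linear_iff linear_add[OF ev(1)] linear_scale[OF ev(1)]
          mult_scaleR algebra_simps)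
  qed (auto simp: span_mon ev_mon v_add mon_add[symmetric])
  moreover have "ev (mon (Poly_Mapping.single i 1)) = z i" for i by (simp add: ev_mon v_def)
  ultimately show thesis using that ev(1) by blast
qed

subsection \<open>Extreme rays\<close>

text \<open>An element of \<open>dual_space V\<close> is 0 off \<open>V\<close> and so in general
  not linear as a total function; \<open>L\<close> makes the laws of linear maps available.\<close>

lemma dual_space_linear_extension:
  fixes l :: "'a::real_vector \<Rightarrow> real"
  assumes "l \<in> dual_space V" "subspace V"
  obtains L where "linear L" "\<And>p. p \<in> V \<Longrightarrow> L p = l p"
proof -
  have l: "\<And>p q. p \<in> V \<Longrightarrow> q \<in> V \<Longrightarrow> l (p + q) = l p + l q" "\<And>c p. p \<in> V \<Longrightarrow> l (c *\<^sub>R p) = c * l p"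
    using assms(1) by (auto simp: dual_space_def)
  obtain B where B: "B \<subseteq> V" "independent B" "V \<subseteq> span B"
    using maximal_independent_subset[of V] by blast
  obtain L where L: "linear L" "\<And>x. x \<in> B \<Longrightarrow> L x = l x"
    using linear_independent_extend[OF B(2), of l] by blast
  have "l 0 = 0" using l(2)[of 0 0] subspace_0[OF assms(2)] by simp
  hence "subspace {p \<in> V. L p = l p}"
    using assms(2) by (auto simp: subspace_def l linear_0[OF L(1)] linear_add[OF L(1)] linear_scale[OF L(1)])
  hence "span B \<subseteq> {p \<in> V. L p = l p}" using B(1) L(2) by (intro span_minimal) auto
  thus thesis using that[OF L(1)] B(3) by blast
qed

lemma restriction_in_dual_space:
  assumes "linear L" "subspace V"
  shows "(\<lambda>p. if p \<in> V then L p else (0::real)) \<in> dual_space V"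
  using assms(2) by (auto simp: dual_space_def subspace_add subspace_scale linear_add[OF assms(1)] linear_scale[OF assms(1)])

lemma midpoint_decomposition: "a = (1 - 1/2) *\<^sub>R (a + x) + (1/2) *\<^sub>R (a + - x)" for a x :: "'a::real_vector"
proof -
  have "(1 - 1/2) *\<^sub>R (a + x) + (1/2) *\<^sub>R (a + - x) = (1/2) *\<^sub>R ((a + x) + (a + - x))"
    by (simp only: scaleR_add_right) simp
  also have "(a + x) + (a + - x) = a + a" by simp
  finally show ?thesis by (simp only: scaleR_half_double)
qed

locale extreme_functional =
  fixes n d :: nat and l L :: "real_mpoly \<Rightarrow> real"
  assumes n_pos: "0 < n" and extreme: "spans_extreme_ray l (sos_dual_cone n d)"
    and lin_L: "linear L" and L_eq: "p \<in> forms n (2 * d) \<Longrightarrow> L p = l p"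
begin

lemma nonzero: "l \<noteq> 0" and face: "{c *\<^sub>R l |c. 0 \<le> c} face_of sos_dual_cone n d"
  using extreme by (auto simp: spans_extreme_ray_def)

lemma l_in_ray: "l \<in> {c *\<^sub>R l |c. 0 \<le> c}"
  by (auto intro!: exI[of _ "1 :: real"])

lemma l_in_cone: "l \<in> sos_dual_cone n d"
  using face_of_imp_subset[OF face] l_in_ray by blast

lemma l_dual: "l \<in> dual_space (forms n (2 * d))"
  using l_in_cone by (simp add: sos_dual_cone_def)

lemma forms_times: "f \<in> forms n d \<Longrightarrow> g \<in> forms n d \<Longrightarrow> f * g \<in> forms n (2 * d)"
  using forms_mult[of f n d g d] by (simp add: mult_2)

lemma square_in_sos: "f \<in> forms n d \<Longrightarrow> f * f \<in> sos_cone n d"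
  unfolding sos_cone_def using forms_times[of f f]
  by (auto intro!: exI[of _ "Suc 0"] exI[of _ "\<lambda>_. f"] simp: power2_eq_square)

sublocale psd_form "forms n d" "\<lambda>f g. L (f * g)"
proof
  show "subspace (forms n d)" by (rule subspace_forms)
  show "bilinear (\<lambda>f g. L (f * g))"
    using bilinear_times by (auto simp: bilinear_def linear_compose[OF _ lin_L, unfolded o_def])
  show "L (f * g) = L (g * f)" for f g by (simp add: mult.commute)
  show "0 \<le> L (f * f)" if "f \<in> forms n d" for f
    using that l_in_cone square_in_sos[OF that] L_eq[OF forms_times[OF that that]]
    by (simp add: sos_dual_cone_def)
qed

lemma forms_finite_span: "finite (mon ` mons n k)" "forms n k \<subseteq> span (mon ` mons n k)"
  using card_mons[OF n_pos, of k] by (simp_all add: forms_eq_span)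

lemma parseval_system: obtains D where "parseval D"
  using parseval_exists[OF forms_finite_span] by blast

lemma rank_eq:
  assumes "parseval D"
  shows "quadratic_form_rank (forms n d) (Q_form l) = card D"
proof -
  have "polar_form (Q_form l) f g = L (f * g)" if "f \<in> forms n d" "g \<in> forms n d" for f g
  proof -
    have "f + g \<in> forms n d" using that by (simp add: subspace_forms subspace_add)
    hence "polar_form (Q_form l) f g = (L ((f + g) * (f + g)) - L (f * f) - L (g * g)) / 2"
      using that by (simp add: polar_form_def Q_form_def power2_eq_square forms_times L_eq)
    thus ?thesis by (simp add: lin sym[of g f])
  qed
  hence "(\<lambda>f g. if g \<in> forms n d then polar_form (Q_form l) f g else 0) ` forms n d = dual ` forms n d"
    by (intro image_cong) (auto simp: dual_def)
  thus ?thesis using dim_dual[OF assms] by (simp add: quadratic_form_rank_def)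
qed

text \<open>\<open>L'\<close> only sees forms modulo \<open>null\<close>, where \<open>L\<close> is
  an inner product on a finite-dimensional space. \<open>C\<close> is the sum of the absolute
  entries of the matrix of \<open>L'\<close> in a Parseval system.\<close>

lemma dominated:
  assumes L': "linear L'" and null: "\<And>f g. f \<in> null \<Longrightarrow> g \<in> forms n d \<Longrightarrow> L' (f * g) = 0"
  obtains C where "0 \<le> C" "\<And>f. f \<in> forms n d \<Longrightarrow> \<bar>L' (f * f)\<bar> \<le> C * L (f * f)"
proof -
  obtain D where D: "parseval D" by (rule parseval_system)
  hence D': "orthonormal D" "finite D" "D \<subseteq> forms n d" by (auto simp: parseval_def orthonormal_def)
  define C where "C = (\<Sum>e\<in>D. \<Sum>e'\<in>D. \<bar>L' (e * e')\<bar>)"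
  have "\<bar>L' (f * f)\<bar> \<le> C * L (f * f)" if f: "f \<in> forms n d" for f
  proof -
    let ?P = "proj D f"
    have P: "?P \<in> forms n d" using proj_in_V[OF D'(1)] .
    \<comment> \<open>Difference of squares: the factor \<open>f - ?P\<close> is null, so
      \<open>f\<close> and its projection have the same square under \<open>L'\<close>.\<close>
    have "L' ((f - ?P) * (f + ?P)) = 0"
      using D f P by (intro null) (auto simp: parseval_def subspace_add subspace_forms)
    moreover have "(f - ?P) * (f + ?P) = f * f - ?P * ?P" by (simp add: algebra_simps)
    ultimately have "L' (f * f) = L' (?P * ?P)" by (simp add: linear_diff[OF L'])
    also have "\<dots> = (\<Sum>e\<in>D. \<Sum>e'\<in>D. L (f * e) * L (f * e') * L' (e * e'))"
      by (simp add: proj_def sum_product mult_scaleR linear_sum[OF L'] linear_scale[OF L'] mult.assoc mult.left_commute)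
    finally have "\<bar>L' (f * f)\<bar> \<le> (\<Sum>e\<in>D. \<Sum>e'\<in>D. \<bar>L (f * e) * L (f * e') * L' (e * e')\<bar>)"
      by (auto intro!: order.trans[OF sum_abs] sum_mono)
    also have "\<dots> \<le> (\<Sum>e\<in>D. \<Sum>e'\<in>D. \<bar>L' (e * e')\<bar> * L (f * f))"
    proof (intro sum_mono)
      fix e e' assume "e \<in> D" "e' \<in> D"
      have sq: "(L (f * e))\<^sup>2 \<le> L (f * f)" if "e \<in> D" for e
      proof -
        have "L (f * f) = (\<Sum>e\<in>D. (L (f * e))\<^sup>2)"
          unfolding parseval_expand[OF D f f] by (intro sum.cong refl) (metis power2_eq_square mult.commute)
        thus ?thesis using that D'(2) member_le_sum[of e D "\<lambda>e. (L (f * e))\<^sup>2"] by simp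
      qed
      have "\<bar>L (f * e)\<bar> * \<bar>L (f * e')\<bar> \<le> sqrt (L (f * f)) * sqrt (L (f * f))"
        using sq[OF \<open>e \<in> D\<close>] sq[OF \<open>e' \<in> D\<close>] by (intro mult_mono real_le_rsqrt) (simp_all add: nonneg f)
      also have "\<dots> = L (f * f)" using nonneg[OF f] by simp
      finally show "\<bar>L (f * e) * L (f * e') * L' (e * e')\<bar> \<le> \<bar>L' (e * e')\<bar> * L (f * f)"
        by (simp add: abs_mult mult.commute[of "\<bar>L' (e * e')\<bar>"] mult_right_mono)
    qed
    finally show ?thesis by (simp add: C_def sum_distrib_right)
  qed
  moreover have "0 \<le> C" by (simp add: C_def sum_nonneg)
  ultimately show thesis using that by blast
qed

text \<open>By domination both \<open>l + t l'\<close> and \<open>l - t l'\<close> lie in the cone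
  for a small \<open>t\<close>. As \<open>l\<close> is their midpoint, the face property puts them
  on the ray of \<open>l\<close>.\<close>

theorem unique_functional:
  assumes l': "l' \<in> dual_space (forms n (2 * d))"
    and null: "\<And>f g. f \<in> null \<Longrightarrow> g \<in> forms n d \<Longrightarrow> l' (f * g) = 0"
  obtains c where "l' = c *\<^sub>R l"
proof -
  obtain L' where L': "linear L'" "\<And>p. p \<in> forms n (2 * d) \<Longrightarrow> L' p = l' p"
    using dual_space_linear_extension[OF l' subspace_forms] by blast
  have "L' (f * g) = 0" if "f \<in> local.null" "g \<in> forms n d" for f g
    using that null[OF that] L'(2)[OF forms_times] by (simp add: null_def)
  then obtain C where C: "0 \<le> C" "\<And>f. f \<in> forms n d \<Longrightarrow> \<bar>L' (f * f)\<bar> \<le> C * L (f * f)"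
    using dominated[OF L'(1)] by blast
  \<comment> \<open>The summand 1 keeps the denominator positive when \<open>C = 0\<close>, and
    \<open>\<delta> * C\<close> stays at most 1.\<close>
  define \<delta> where "\<delta> = 1 / (C + 1)"
  have \<delta>: "0 < \<delta>" "\<delta> * C \<le> 1" using C(1) by (simp_all add: \<delta>_def)
  have in_cone: "l + t *\<^sub>R l' \<in> sos_dual_cone n d" if "\<bar>t\<bar> = \<delta>" for t
    unfolding sos_dual_cone_def
  proof safe
    show "l + t *\<^sub>R l' \<in> dual_space (forms n (2 * d))"
      using l_dual l' by (auto simp: dual_space_def scaleR_fun_def algebra_simps)
    fix p assume "p \<in> sos_cone n d"
    then obtain k q where p: "p \<in> forms n (2 * d)" and q: "\<And>i. i < (k::nat) \<Longrightarrow> q i \<in> forms n d"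
      "p = (\<Sum>i<k. (q i)\<^sup>2)" by (auto simp: sos_cone_def)
    have "0 \<le> L (q i * q i) + t * L' (q i * q i)" if "i < k" for i
    proof -
      have "\<bar>t * L' (q i * q i)\<bar> \<le> \<delta> * (C * L (q i * q i))"
        using C(2)[OF q(1)[OF that]] \<delta>(1) \<open>\<bar>t\<bar> = \<delta>\<close> by (simp add: abs_mult mult_left_mono)
      also have "\<dots> \<le> L (q i * q i)"
        using mult_right_mono[OF \<delta>(2) nonneg[OF q(1)[OF that]]] by (simp add: mult.assoc)
      finally show ?thesis by linarith
    qed
    hence "0 \<le> (\<Sum>i<k. L (q i * q i) + t * L' (q i * q i))" by (intro sum_nonneg) auto
    also have "\<dots> = L p + t * L' p"
      by (simp add: q(2) linear_sum[OF lin_L] linear_sum[OF L'(1)] sum.distrib sum_distrib_left power2_eq_square)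
    also have "\<dots> = (l + t *\<^sub>R l') p" using p by (simp add: L_eq L'(2) scaleR_fun_def)
    finally show "0 \<le> (l + t *\<^sub>R l') p" .
  qed
  show thesis
  proof (cases "l' = 0")
    case True
    then have "l' = 0 *\<^sub>R l" by simp
    then show thesis by (rule that)
  next
    case False
    have "l + \<delta> *\<^sub>R l' \<noteq> l + (-\<delta>) *\<^sub>R l'"
    proof
      assume "l + \<delta> *\<^sub>R l' = l + (-\<delta>) *\<^sub>R l'"
      hence "\<delta> *\<^sub>R l' = (-\<delta>) *\<^sub>R l'" by (rule add_left_imp_eq)
      hence "\<delta> = -\<delta>" by (rule scaleR_right_imp_eq[OF False])
      thus False using \<delta>(1) by simp
    qed
    moreover have "l = (1 - 1/2) *\<^sub>R (l + \<delta> *\<^sub>R l') + (1/2) *\<^sub>R (l + (-\<delta>) *\<^sub>R l')"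
      using midpoint_decomposition[of l "\<delta> *\<^sub>R l'"] by (simp only: scaleR_minus_left)
    ultimately have "l \<in> open_segment (l + \<delta> *\<^sub>R l') (l + (-\<delta>) *\<^sub>R l')"
      unfolding in_segment by (intro conjI exI[of _ "1/2"]) simp_all
    moreover have "l + \<delta> *\<^sub>R l' \<in> sos_dual_cone n d" "l + (-\<delta>) *\<^sub>R l' \<in> sos_dual_cone n d"
      using \<delta>(1) by (intro in_cone; simp)+
    ultimately have "l + \<delta> *\<^sub>R l' \<in> {c *\<^sub>R l |c. 0 \<le> c}"
      using face_ofD[OF face] l_in_ray by blast
    then obtain c where "l + \<delta> *\<^sub>R l' = c *\<^sub>R l" by blast
    hence "\<delta> *\<^sub>R l' = c *\<^sub>R l - l" by (metis add_diff_cancel_left')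
    hence "\<delta> *\<^sub>R l' = (c - 1) *\<^sub>R l" by (simp only: scaleR_diff_left scaleR_one)
    hence "(1 / \<delta>) *\<^sub>R \<delta> *\<^sub>R l' = (1 / \<delta>) *\<^sub>R (c - 1) *\<^sub>R l" by (rule arg_cong)
    hence "l' = ((c - 1) / \<delta>) *\<^sub>R l" using \<delta>(1) by simp
    thus thesis by (rule that)
  qed
qed

text \<open>In other words, the products of null forms with forms of degree \<open>d\<close> have codimension at most one.\<close>

theorem codimension_one:
  assumes "finite G" "\<And>f g. f \<in> null \<Longrightarrow> g \<in> forms n d \<Longrightarrow> f * g \<in> span G"
  shows "card (mons n (2 * d)) \<le> card G + 1"
proof (rule ccontr)
  assume less: "\<not> ?thesis"
  obtain p1 where p1: "l p1 \<noteq> 0" using nonzero by (auto simp: fun_eq_iff)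
  have p1': "p1 \<in> forms n (2 * d)" using p1 l_dual by (auto simp: dual_space_def)
  obtain B where B: "B \<subseteq> insert p1 G" "independent B" "insert p1 G \<subseteq> span B"
    using maximal_independent_subset[of "insert p1 G"] by blast
  have finB: "finite B" "card B \<le> card G + 1"
    using B(1) assms(1) finite_subset[of B "insert p1 G"] card_mono[of "insert p1 G" B]
      card_insert_le_m1[of "card G + 1" G p1] by (auto simp: card_insert_if split: if_splits)
  have "\<not> mon ` mons n (2 * d) \<subseteq> span B"
  proof
    assume "mon ` mons n (2 * d) \<subseteq> span B"
    hence "card (mon ` mons n (2 * d)) \<le> card B"
      using independent_span_bound[OF finB(1) independent_mon] by blast
    thus False using less finB(2) by (simp add: card_image inj_on_subset[OF inj_mon])
  qed
  then obtain p2 where p2: "p2 \<in> mon ` mons n (2 * d)" "p2 \<notin> span B" by blast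
  have p2': "p2 \<in> forms n (2 * d)" using p2(1) by (simp add: forms_eq_span span_base)
  \<comment> \<open>\<open>h\<close> vanishes on \<open>G\<close> and at \<open>p1\<close>, but is 1
    at \<open>p2\<close>. Being a multiple of \<open>l\<close>, with \<open>l p1\<close> nonzero, it
    would have to be zero on all forms.\<close>
  obtain h :: "real_mpoly \<Rightarrow> real" where h: "linear h" "\<And>x. x \<in> insert p2 B \<Longrightarrow> h x = of_bool (x = p2)"
    using linear_independent_extend[OF independent_insertI[OF p2(2) B(2)], of "\<lambda>x. of_bool (x = p2)"] by blast
  have "h x = 0" if "x \<in> span B" for x
  proof -
    have "span B \<subseteq> {x. h x = 0}"
      using h p2(2) span_base[of p2 B] by (intro span_minimal linear_subspace_kernel) auto
    thus ?thesis using that by blast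
  qed
  moreover have "span (insert p1 G) \<subseteq> span B" using B(3) by (simp add: span_minimal)
  ultimately have h0: "h x = 0" if "x \<in> span (insert p1 G)" for x using that by blast
  have "f * g \<in> span (insert p1 G)" if "f \<in> null" "g \<in> forms n d" for f g
    using assms(2)[OF that] span_mono[of G "insert p1 G"] by blast
  then have "(if f * g \<in> forms n (2 * d) then h (f * g) else 0) = 0"
    if "f \<in> null" "g \<in> forms n d" for f g using h0 that by simp
  then obtain c where c: "(\<lambda>p. if p \<in> forms n (2 * d) then h p else 0) = c *\<^sub>R l"
    by (rule unique_functional[OF restriction_in_dual_space[OF h(1) subspace_forms]])
  have "h p1 = c * l p1" "h p2 = c * l p2"
    using fun_cong[OF c, of p1] fun_cong[OF c, of p2] p1' p2' by (simp_all add: scaleR_fun_def)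
  thus False using p1 h0[of p1] h(2)[of p2] by (simp add: span_base)
qed

end

subsection \<open>Quartic forms in four variables\<close>

lemma mons_split:
  assumes "m \<in> mons n (d + d')"
  obtains m1 m2 where "m1 \<in> mons n d" "m2 \<in> mons n d'" "m = m1 + m2"
  using assms
proof (induction d arbitrary: m thesis)
  case 0
  show ?case using 0(1)[of 0 m] 0(2) by (simp add: mons_0)
next
  case (Suc d)
  from Suc.prems(2) obtain i m' where i: "i < n" "m' \<in> mons n (d + d')" "m = Poly_Mapping.single i 1 + m'"
    by (auto elim: mons_Suc)
  obtain m1 m2 where "m1 \<in> mons n d" "m2 \<in> mons n d'" "m' = m1 + m2"
    using Suc.IH[OF _ i(2)] by blast
  then show ?case
    using Suc.prems(1)[of "Poly_Mapping.single i 1 + m1" m2] i mons_add[OF single_in_mons[OF i(1)], of m1 d]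
    by (simp add: add.assoc)
qed

lemma forms_add_span:
  "forms n (d + d') \<subseteq> span ((\<lambda>(f, g). f * g) ` (forms n d \<times> forms n d'))"
proof -
  have "mon m \<in> span ((\<lambda>(f, g). f * g) ` (forms n d \<times> forms n d'))" if m: "m \<in> mons n (d + d')" for m
  proof -
    obtain m1 m2 where "m1 \<in> mons n d" "m2 \<in> mons n d'" "m = m1 + m2"
      using mons_split[OF m] by blast
    hence "mon m = mon m1 * mon m2" "mon m1 \<in> forms n d" "mon m2 \<in> forms n d'"
      by (simp_all add: mon_add forms_eq_span span_base)
    thus ?thesis by (force intro: span_base)
  qed
  thus ?thesis unfolding forms_eq_span[of n "d + d'"] by (intro span_minimal) auto
qed

text \<open>Coordinates on the space of linear forms; the product type is a Euclidean space of
  dimension 4, as the quartic locales require.\<close>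

definition linear_form :: "real \<times> real \<times> real \<times> real \<Rightarrow> real_mpoly" where
  "linear_form = (\<lambda>(p, q, r, s). p *\<^sub>R mon (Poly_Mapping.single 0 1) + q *\<^sub>R mon (Poly_Mapping.single 1 1)
     + r *\<^sub>R mon (Poly_Mapping.single 2 1) + s *\<^sub>R mon (Poly_Mapping.single 3 1))"

lemma linear_linear_form: "linear linear_form"
  by (rule linearI) (auto simp: linear_form_def algebra_simps)

lemma inj_linear_form: "inj linear_form"
proof (rule linear_injective_0[OF linear_linear_form, THEN iffD2], intro allI impI)
  fix x assume 0: "linear_form x = 0"
  obtain p q r s where x: "x = (p, q, r, s)" by (cases x) auto
  have ne: "Poly_Mapping.single i (Suc 0) = Poly_Mapping.single j (Suc 0) \<longleftrightarrow> i = j" for i j :: nat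
    by (metis lookup_single_eq lookup_single_not_eq nat.distinct(1))
  have "Poly_Mapping.lookup (linear_form x) (Poly_Mapping.single i 1) = 0" for i using 0 by simp
  from this[of 0] this[of 1] this[of 2] this[of 3] show "x = 0"
    by (simp add: x linear_form_def lookup_add lookup_single ne zero_prod_def when_def)
qed

lemma range_linear_form: "range linear_form = forms 4 1"
proof
  have "mon (Poly_Mapping.single i 1) \<in> forms 4 1" if "i < 4" for i
    using single_in_mons[OF that] by (simp add: forms_eq_span span_base)
  thus "range linear_form \<subseteq> forms 4 1"
    by (auto simp: linear_form_def intro!: subspace_add subspace_scale subspace_forms)
  have "mon m \<in> range linear_form" if m: "m \<in> mons 4 1" for m
  proof -
    obtain i m' where "i < 4" "m' \<in> mons 4 0" "m = Poly_Mapping.single i 1 + m'"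
      using m mons_Suc[of m 4 0] by auto
    hence i: "i < 4" "m = Poly_Mapping.single i 1" by (simp_all add: mons_0)
    have "mon m = linear_form (of_bool (i = 0), of_bool (i = 1), of_bool (i = 2), of_bool (i = 3))"
      using i by (auto simp: linear_form_def less_Suc_eq numeral_eq_Suc)
    thus ?thesis by blast
  qed
  moreover have "subspace (range linear_form)"
    by (intro linear_subspace_image linear_linear_form subspace_UNIV)
  ultimately show "forms 4 1 \<subseteq> range linear_form"
    unfolding forms_eq_span by (intro span_minimal) auto
qed

lemma span_linear_form_products: "span (range (\<lambda>(x, y). linear_form x * linear_form y)) = forms 4 2"
proof
  have "linear_form x * linear_form y \<in> forms 4 2" for x y
    using forms_mult[of "linear_form x" 4 1 "linear_form y" 1] range_linear_form by (auto simp: numeral_2_eq_2)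
  thus "span (range (\<lambda>(x, y). linear_form x * linear_form y)) \<subseteq> forms 4 2"
    by (intro span_minimal subspace_forms) auto
  have "forms 4 (1 + 1) \<subseteq> span ((\<lambda>(f, g). f * g) ` (range linear_form \<times> range linear_form))"
    unfolding range_linear_form by (rule forms_add_span)
  moreover have "(\<lambda>(f, g). f * g) ` (range linear_form \<times> range linear_form) =
      range (\<lambda>(x, y). linear_form x * linear_form y)" by (auto simp: image_iff) 
  ultimately show "forms 4 2 \<subseteq> span (range (\<lambda>(x, y). linear_form x * linear_form y))"
    by (simp only: one_add_one)
qed

lemma card_mons_4: "card (mons 4 (Suc 0)) = 4" "card (mons 4 2) = 10" "card (mons 4 3) = 20" "card (mons 4 4) = 35"
  "finite (mons 4 d)"
  using card_mons[of 4 1] card_mons[of 4 2] card_mons[of 4 3] card_mons[of 4 4] card_mons[of 4 d]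
  by (simp_all add: numeral_eq_Suc)

section \<open>Possible ranks for extreme functionals on quaternary quartics\<close>

locale extreme_quaternary_quartic = extreme_functional 4 2 l L for l L :: "real_mpoly \<Rightarrow> real"
begin

sublocale q: psd_quartic "\<lambda>x y. linear_form x * linear_form y" "\<lambda>f g. L (f * g)"
proof
  show "bilinear (\<lambda>x y. linear_form x * linear_form y)"
    by (auto simp: bilinear_def linear_iff linear_add[OF linear_linear_form] linear_scale[OF linear_linear_form]
      mult_scaleR algebra_simps)
  show "bilinear (\<lambda>f g. L (f * g))" by (rule bil)
  show "0 \<le> L (f * f)" if "f \<in> span (range (\<lambda>(x, y). linear_form x * linear_form y))" for f
    using that nonneg by (simp add: span_linear_form_products)
qed (simp_all add: mult_ac)

lemma H_eq: "q.H = forms 4 2"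
  by (simp add: q.H_def span_linear_form_products)

lemma card_independent_le:
  assumes "orthonormal D" "independent B" "B \<subseteq> null"
  shows "finite B" "card D + card B \<le> 10"
proof -
  have fin: "finite (mon ` mons 4 2)" "card (mon ` mons 4 2) \<le> 10"
    using card_image_le[of "mons 4 2" mon] by (simp_all add: card_mons_4)
  have "D \<union> B \<subseteq> span (mon ` mons 4 2)"
    using assms forms_finite_span(2)[of 2] by (auto simp: orthonormal_def null_def)
  from independent_span_bound[OF fin(1) independent_orthonormal_Un(1)[OF assms] this]
  have "finite (D \<union> B)" "card (D \<union> B) \<le> 10" using fin(2) by auto
  thus "finite B" "card D + card B \<le> 10"
    using independent_orthonormal_Un(2)[OF assms] by (simp_all add: card_Un_disjoint)
qed

lemma rank_le_6:
  assumes "parseval D"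
  shows "card D \<le> 6"
proof -
  obtain B where B: "B \<subseteq> null" "independent B" "null \<subseteq> span B"
    using maximal_independent_subset[of null] by blast
  have fin: "finite B" "card D + card B \<le> 10"
    using card_independent_le[OF _ B(2,1)] assms by (auto simp: parseval_def)
  let ?G = "(\<lambda>(w, m). w * mon m) ` (B \<times> mons 4 2)"
  have "card (mons 4 (2 * 2)) \<le> card ?G + 1"
  proof (rule codimension_one)
    show "finite ?G" using fin(1) card_mons_4(5) by simp
    fix f g assume "f \<in> null" "g \<in> forms 4 2"
    then have "f \<in> span B" "g \<in> span (mon ` mons 4 2)"
      using B(3) forms_finite_span(2)[of 2] by blast+
    then show "f * g \<in> span ?G"
      by (rule span_times) (force intro: span_base)
  qed
  also have "card ?G \<le> card B * 10"
    using card_image_le[of "B \<times> mons 4 2" "\<lambda>(w, m). w * mon m"] fin(1) by (simp add: card_mons_4 card_cartesian_product)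
  finally show ?thesis using fin(2) by (simp add: card_mons_4)
qed

text \<open>The multiples of \<open>linear_form x\<close> give four null forms, but their products
  with quadratic forms lie in the 20-dimensional space of its multiples by cubics. Rank 5 or more
  would leave at most one further null form, and 20 + 10 + 1 is less than 35.\<close>

lemma rank_le_4:
  assumes "parseval D" "x \<in> q.N" "x \<noteq> 0"
  shows "card D \<le> 4"
proof (rule ccontr)
  assume "\<not> card D \<le> 4"
  let ?a = "linear_form x"
  have "?a \<noteq> 0"
    using assms(3) inj_linear_form linear_0[OF linear_linear_form] by (metis injD)
  have lin: "linear ((*) ?a)" using bilinear_times by (simp add: bilinear_def)
  have inj: "inj ((*) ?a)" using \<open>?a \<noteq> 0\<close> by (auto intro: injI)
  define B0 where "B0 = (*) ?a ` mon ` mons 4 1"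
  have B0: "independent B0" unfolding B0_def
    by (rule linear_independent_injective_image[OF lin independent_mon]) (use inj in \<open>auto simp: inj_on_def\<close>)
  have card_B0: "card B0 = 4"
    unfolding B0_def by (simp add: card_image inj_on_subset[OF inj] inj_on_subset[OF inj_mon] card_mons_4)
  have "B0 \<subseteq> null"
  proof
    fix f assume "f \<in> B0"
    then obtain m where m: "m \<in> mons 4 1" "f = ?a * mon m" by (auto simp: B0_def)
    then obtain y where y: "mon m = linear_form y"
      using range_linear_form span_base[of "mon m" "mon ` mons 4 1"] unfolding forms_eq_span by blast
    have "f \<in> forms 4 2" using q.m_in_H[of x y] by (simp add: H_eq m y)
    moreover have "L (f * g) = 0" if "g \<in> forms 4 2" for g
      using q.N_null[OF assms(2), of g y] that by (simp add: H_eq m y)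
    ultimately show "f \<in> null" by (simp add: null_def)
  qed
  then obtain B where B: "B0 \<subseteq> B" "B \<subseteq> null" "independent B" "null \<subseteq> span B"
    using maximal_independent_subset_extend[OF _ B0] by blast
  have fin: "finite B" "card D + card B \<le> 10"
    using card_independent_le[OF _ B(3,2)] assms by (auto simp: parseval_def)
  have "card (B - B0) \<le> 1"
    using fin \<open>\<not> card D \<le> 4\<close> card_B0 B(1) by (simp add: card_Diff_subset finite_subset)
  let ?G1 = "(\<lambda>m. ?a * mon m) ` mons 4 3" and ?G2 = "(\<lambda>(w, m). w * mon m) ` ((B - B0) \<times> mons 4 2)"
  have "card (mons 4 (2 * 2)) \<le> card (?G1 \<union> ?G2) + 1"
  proof (rule codimension_one)
    show "finite (?G1 \<union> ?G2)" using fin(1) card_mons_4(5) by simp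
    fix f g assume "f \<in> null" "g \<in> forms 4 2"
    then have "f \<in> span B" "g \<in> span (mon ` mons 4 2)"
      using B(4) forms_finite_span(2)[of 2] by blast+
    moreover have "w * p \<in> span (?G1 \<union> ?G2)" if w: "w \<in> B" and p: "p \<in> mon ` mons 4 2" for w p
    proof -
      obtain m where m: "p = mon m" "m \<in> mons 4 2" using p by blast
      show ?thesis
      proof (cases "w \<in> B0")
        case True
        then obtain m' where m': "w = ?a * mon m'" "m' \<in> mons 4 1" by (auto simp: B0_def)
        have "m' + m \<in> mons 4 3" using mons_add[OF m'(2) m(2)] by (simp add: numeral_3_eq_3)
        moreover have "w * p = ?a * mon (m' + m)" by (simp add: m m' mon_add mult.assoc)
        ultimately show ?thesis by (intro span_base) auto
      next
        case False
        then show ?thesis using w m by (intro span_base) auto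
      qed
    qed
    ultimately show "f * g \<in> span (?G1 \<union> ?G2)" by (rule span_times)
  qed
  moreover have "card ?G1 \<le> 20"
    using card_image_le[of "mons 4 3" "\<lambda>m. ?a * mon m"] by (simp add: card_mons_4)
  moreover have "card ?G2 \<le> card (B - B0) * 10"
    using card_image_le[of "(B - B0) \<times> mons 4 2" "\<lambda>(w, m). w * mon m"] fin(1)
    by (simp add: card_mons_4 card_cartesian_product)
  moreover have "card (?G1 \<union> ?G2) \<le> card ?G1 + card ?G2" by (rule card_Un_le)
  ultimately show False using \<open>card (B - B0) \<le> 1\<close> by (simp add: card_mons_4)
qed


lemma L_nonzero: obtains f g where "f \<in> forms 4 2" "g \<in> forms 4 2" "L (f * g) \<noteq> 0"
proof -
  have "\<exists>f\<in>forms 4 2. \<exists>g\<in>forms 4 2. L (f * g) \<noteq> 0"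
  proof (rule ccontr)
    assume "\<not> ?thesis"
    hence "(\<lambda>(f, g). f * g) ` (forms 4 2 \<times> forms 4 2) \<subseteq> {p. L p = 0}" by auto
    hence "span ((\<lambda>(f, g). f * g) ` (forms 4 2 \<times> forms 4 2)) \<subseteq> {p. L p = 0}"
      by (rule span_minimal[OF _ linear_subspace_kernel[OF lin_L]])
    moreover have "forms 4 (2 * 2) \<subseteq> span ((\<lambda>(f, g). f * g) ` (forms 4 2 \<times> forms 4 2))"
      using forms_add_span[of 4 2 2] by simp
    ultimately have "l p = 0" for p
      using L_eq[of p] l_dual by (cases "p \<in> forms 4 (2 * 2)") (auto simp: dual_space_def)
    thus False using nonzero by (simp add: fun_eq_iff)
  qed
  thus thesis using that by blast
qed

text \<open>If the fourth power of the generic form had value 0, then \<open>a\<close> would lie in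
  \<open>N\<close>, so that \<open>ker a\<close>, and with it \<open>N\<close>, would be everything
  and \<open>L\<close> would vanish on all quartics.\<close>

lemma generic_normalized:
  obtains a where "q.ker a = q.N" "L (linear_form a * linear_form a * (linear_form a * linear_form a)) = 1"
proof -
  obtain a where a: "q.ker a = q.N" by (rule q.generic_element)
  define c where "c = L (linear_form a * linear_form a * (linear_form a * linear_form a))"
  have "c \<noteq> 0"
  proof
    assume "c = 0"
    hence "a \<in> q.N" by (simp add: q.N_def c_def)
    hence "x \<in> q.N" for x using q.N_null[of a _ x] a by (auto simp: q.ker_def)
    hence 0: "L (linear_form x * linear_form y * f) = 0" if "f \<in> forms 4 2" for x y f
      using q.N_null[of x f y] that by (simp add: H_eq)
    have "L (f * g) = 0" if f: "f \<in> forms 4 2" and g: "g \<in> forms 4 2" for f g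
    proof -
      have "span (range (\<lambda>(x, y). linear_form x * linear_form y)) \<subseteq> {f. L (f * g) = 0}"
      proof (rule span_minimal)
        show "subspace {f. L (f * g) = 0}"
          by (auto simp: subspace_def lin linear_0[OF lin_L])
      qed (use 0 g in auto)
      thus ?thesis using f span_linear_form_products by blast
    qed
    thus False using L_nonzero by metis
  qed
  moreover have "0 \<le> c" unfolding c_def using q.psd_H[OF q.m_in_H, of a a] .
  ultimately have "0 < c" by simp
  \<comment> \<open>The value is of degree 4 in \<open>a\<close>, hence the fourth root.\<close>
  define r where "r = inverse (root 4 c)"
  have r: "r \<noteq> 0" "r ^ 4 * c = 1"
    using \<open>0 < c\<close> by (simp_all add: r_def power_inverse real_root_pow_pos2)
  have lf: "linear_form (r *\<^sub>R a) = r *\<^sub>R linear_form a"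
    by (rule linear_scale[OF linear_linear_form])
  show thesis
  proof (rule that[of "r *\<^sub>R a"])
    show "q.ker (r *\<^sub>R a) = q.N"
      unfolding a[symmetric] set_eq_iff q.ker_iff lf
      using r(1) by (simp add: mult_scaleR linear_scale[OF lin_L])
    show "L (linear_form (r *\<^sub>R a) * linear_form (r *\<^sub>R a) * (linear_form (r *\<^sub>R a) * linear_form (r *\<^sub>R a))) = 1"
      unfolding lf using r(2)
      by (simp add: mult_scaleR linear_scale[OF lin_L] c_def power4_eq_xxxx mult.assoc)
  qed
qed

text \<open>On quadratic forms the evaluation \<open>E\<close> is pairing with \<open>w\<close>, so
  it kills \<open>null\<close>; being multiplicative, it kills all products with null forms. Then
  \<open>unique_functional\<close> makes it a multiple of \<open>l\<close>.\<close>

lemma rank_1_of_evaluation: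
  assumes D: "parseval D" and z: "linear z" "z x0 \<noteq> 0" and w: "w \<in> forms 4 2"
    and ev: "\<And>x y. L (w * (linear_form x * linear_form y)) = z x * z y"
  shows "card D = 1"
proof -
  let ?b = "\<lambda>i. (of_bool (i = 0), of_bool (i = 1), of_bool (i = 2), of_bool (i = (3::nat))) :: real \<times> real \<times> real \<times> real"
  obtain E :: "real_mpoly \<Rightarrow> real" where E: "linear E" "\<And>f g. E (f * g) = E f * E g"
    "\<And>i. E (mon (Poly_Mapping.single i 1)) = z (?b i)"
    using evaluation_exists[of "\<lambda>i. z (?b i)"] by blast
  have E_lf: "E (linear_form x) = z x" for x
  proof -
    obtain p q r s where x: "x = (p, q, r, s)" by (cases x) auto
    have "x = p *\<^sub>R ?b 0 + q *\<^sub>R ?b 1 + r *\<^sub>R ?b 2 + s *\<^sub>R ?b 3" by (simp add: x)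
    hence "z x = p * z (?b 0) + q * z (?b 1) + r * z (?b 2) + s * z (?b 3)"
      by (simp only: linear_add[OF z(1)] linear_scale[OF z(1)] real_scaleR_def)
    moreover have "E (linear_form x) = p * E (mon (Poly_Mapping.single 0 1)) + q * E (mon (Poly_Mapping.single 1 1))
        + r * E (mon (Poly_Mapping.single 2 1)) + s * E (mon (Poly_Mapping.single 3 1))"
      by (simp only: x linear_form_def prod.case linear_add[OF E(1)] linear_scale[OF E(1)] real_scaleR_def)
    ultimately show ?thesis by (simp only: E(3))
  qed
  have E_w: "E f = L (w * f)" if "f \<in> forms 4 2" for f
  proof -
    have "span (range (\<lambda>(x, y). linear_form x * linear_form y)) \<subseteq> {f. E f - L (w * f) = 0}"
    proof (rule span_minimal)
      show "subspace {f. E f - L (w * f) = 0}"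
        by (auto simp: subspace_def lin linear_0[OF lin_L] linear_0[OF E(1)] linear_add[OF E(1)] linear_scale[OF E(1)])
    qed (auto simp: E(2) E_lf ev)
    thus ?thesis using that span_linear_form_products by auto
  qed
  have null: "(if f * g \<in> forms 4 (2 * 2) then E (f * g) else 0) = 0"
    if "f \<in> null" "g \<in> forms 4 2" for f g
  proof -
    have "L (f * w) = 0" "f \<in> forms 4 2" using that w by (auto simp: null_def)
    thus ?thesis using E_w[of f] by (simp add: E(2) mult.commute)
  qed
  obtain c where c: "(\<lambda>p. if p \<in> forms 4 (2 * 2) then E p else 0) = c *\<^sub>R l"
    by (rule unique_functional[OF restriction_in_dual_space[OF E(1) subspace_forms] null])
  have prod: "E f * E g = c * L (f * g)" if "f \<in> forms 4 2" "g \<in> forms 4 2" for f g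
    using fun_cong[OF c, of "f * g"] forms_times[OF that] L_eq[OF forms_times[OF that]]
    by (simp add: scaleR_fun_def E(2))
  let ?f = "linear_form x0 * linear_form x0"
  have f: "?f \<in> forms 4 2" using q.m_in_H[of x0 x0] by (simp add: H_eq)
  have "E ?f * E ?f \<noteq> 0" using z(2) by (simp add: E(2) E_lf)
  hence L0: "L (?f * ?f) \<noteq> 0" "c \<noteq> 0" using prod[OF f f] by auto
  \<comment> \<open>Up to the nonzero factor \<open>c\<close> the pairing is
    \<open>E e * E e'\<close>, which cannot be 0 for two vectors of nonzero length.\<close>
  have "e = e'" if "e \<in> D" "e' \<in> D" for e e'
  proof (rule ccontr)
    assume "e \<noteq> e'"
    hence "L (e * e) = 1" "L (e' * e') = 1" "L (e * e') = 0" "e \<in> forms 4 2" "e' \<in> forms 4 2"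
      using that D by (auto simp: parseval_def orthonormal_def)
    hence "E e * E e = c" "E e' * E e' = c" "E e * E e' = 0" using prod by auto
    thus False using L0(2) by auto
  qed
  moreover have "D \<noteq> {}" using parseval_expand[OF D f f] L0(1) by auto
  ultimately show ?thesis
    by (metis card_1_singleton_iff is_singletonI' is_singleton_def One_nat_def)
qed

lemma rank_1_of_rank_le_5:
  assumes D: "parseval D" and D5: "card D \<le> 5"
  shows "card D = 1"
proof -
  obtain a where a: "q.ker a = q.N" "L (linear_form a * linear_form a * (linear_form a * linear_form a)) = 1"
    by (rule generic_normalized)
  define m where "m = (\<lambda>x y. linear_form x * linear_form y)"
  have m_V: "m x y \<in> forms 4 2" for x y using q.m_in_H[of x y] by (simp add: H_eq m_def)
  have lin_m: "linear (m a)"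
    unfolding m_def by (rule linearI)
      (simp_all add: linear_add[OF linear_linear_form] linear_scale[OF linear_linear_form] mult_scaleR algebra_simps)
  define U where "U = range (m a)"
  have U_V: "U \<subseteq> forms 4 2" using m_V unfolding U_def by blast
  have sub_U: "subspace U" unfolding U_def by (intro linear_subspace_image lin_m subspace_UNIV)
  interpret U: psd_form U "\<lambda>f g. L (f * g)"
    by standard (use sub_U bil nonneg U_V in \<open>auto simp: mult.commute\<close>)
  obtain DU where DU: "U.parseval DU"
    using U.parseval_exists[OF forms_finite_span(1)[of 2]] U_V forms_finite_span(2)[of 2] by blast
  have DU_o: "orthonormal DU" and DU_fin: "finite DU" and DU_U: "DU \<subseteq> U"
    using DU U_V by (auto simp: U.parseval_def U.orthonormal_def orthonormal_def)
  \<comment> \<open>Orthogonality to \<open>U\<close> alone suffices: a member of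
    \<open>U.null\<close> has length 0, and positivity makes it null among all quadratic
    forms.\<close>
  have U_null: "U.null \<subseteq> null"
  proof
    fix f assume "f \<in> U.null"
    hence "f \<in> forms 4 2" "L (f * f) = 0" using U_V by (auto simp: U.null_def)
    thus "f \<in> null" by (rule nullI)
  qed
  have projU: "m a x - proj DU (m a x) \<in> null" for x
  proof -
    have "m a x \<in> U" by (simp add: U_def)
    thus ?thesis using DU U_null by (auto simp: U.parseval_def U.proj_def proj_def)
  qed
  obtain Y where Y: "inj_on (m a) Y" "DU = m a ` Y"
    using DU_U unfolding U_def by (metis subset_image_inj subset_UNIV)
  have finY: "finite Y" and cardY: "card DU = card Y"
    using DU_fin Y by (auto simp: card_image finite_image_iff)
  \<comment> \<open>\<open>Y\<close> consists of preimages of the orthonormal system of the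
    multiples of \<open>a\<close>. Because \<open>ker a = N\<close>, it spans the linear forms
    modulo \<open>N\<close>.\<close>
  have decomp: "\<exists>v\<in>span Y. x - v \<in> q.N" for x
  proof -
    define v where "v = (\<Sum>y\<in>Y. L (m a x * m a y) *\<^sub>R y)"
    have "m a v = proj DU (m a x)"
      by (simp add: v_def linear_sum[OF lin_m] linear_scale[OF lin_m] proj_def Y(2) sum.reindex[OF Y(1)])
    hence "m a (x - v) \<in> null" using projU by (simp add: linear_diff[OF lin_m])
    hence "L (m a (x - v) * m a (x - v)) = 0" using m_V unfolding null_def by blast
    hence "x - v \<in> q.ker a" using q.swap[of a "x - v" a "x - v"] by (simp add: q.ker_iff m_def)
    moreover have "v \<in> span Y" unfolding v_def by (intro span_sum span_scale span_base)
    ultimately show ?thesis using a(1) by blast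
  qed
  let ?S = "(\<lambda>(x, y). m x y) ` (Y \<times> Y)"
  have "card D \<le> card ?S"
  proof (rule card_parseval_le[OF D])
    show "finite ?S" using finY by simp
    show "?S \<subseteq> forms 4 2" by (auto intro: m_V)
    let ?T = "{f \<in> forms 4 2. \<exists>s\<in>span ?S. f - s \<in> null}"
    have "subspace ?T"
      unfolding subspace_def
    proof (intro conjI ballI allI)
      show "0 \<in> ?T"
        using subspace_0[OF subspace_forms] subspace_0[OF subspace_null] by (auto intro!: bexI[of _ 0] simp: span_zero)
    next
      fix f g assume "f \<in> ?T" "g \<in> ?T"
      then obtain s t where st: "f \<in> forms 4 2" "g \<in> forms 4 2" "s \<in> span ?S" "f - s \<in> null"
        "t \<in> span ?S" "g - t \<in> null" by blast
      have "f + g - (s + t) \<in> null"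
        using subspace_add[OF subspace_null st(4,6)] by (simp add: algebra_simps)
      thus "f + g \<in> ?T" using span_add[OF st(3,5)] subspace_add[OF subspace_forms st(1,2)] by blast
    next
      fix c f assume "f \<in> ?T"
      then obtain s where s: "f \<in> forms 4 2" "s \<in> span ?S" "f - s \<in> null" by blast
      have "c *\<^sub>R f - c *\<^sub>R s \<in> null"
        using subspace_scale[OF subspace_null s(3), of c] by (simp add: scaleR_diff_right)
      thus "c *\<^sub>R f \<in> ?T" using span_scale[OF s(2)] subspace_scale[OF subspace_forms s(1)] by blast
    qed
    moreover have "m x x' \<in> ?T" for x x'
    proof -
      obtain v v' where v: "v \<in> span Y" "x - v \<in> q.N" "v' \<in> span Y" "x' - v' \<in> q.N"
        using decomp by metis
      have Nn: "m u y \<in> null" if "u \<in> q.N" for u y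
        using m_V q.N_null[OF that] by (simp add: null_def H_eq m_def)
      have "linear_form v \<in> span (linear_form ` Y)" "linear_form v' \<in> span (linear_form ` Y)"
        using v by (simp_all add: linear_span_image[OF linear_linear_form])
      hence "linear_form v * linear_form v' \<in> span ?S"
      proof (rule span_times)
        fix p p' assume "p \<in> linear_form ` Y" "p' \<in> linear_form ` Y"
        then obtain y y' where y: "y \<in> Y" "y' \<in> Y" "p = linear_form y" "p' = linear_form y'" by blast
        hence "p * p' \<in> ?S" by (intro image_eqI[of _ _ "(y, y')"]) (simp_all add: m_def)
        thus "p * p' \<in> span ?S" by (rule span_base)
      qed
      hence "m v v' \<in> span ?S" by (simp add: m_def)
      moreover have "m x x' - m v v' = m (x - v) x' + m (x' - v') v"
        by (simp add: m_def linear_diff[OF linear_linear_form] algebra_simps)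
      hence "m x x' - m v v' \<in> null"
        using Nn v by (simp add: subspace_add subspace_null)
      ultimately show ?thesis using m_V by blast
    qed
    ultimately have "span (range (\<lambda>(x, y). m x y)) \<subseteq> ?T" by (intro span_minimal) auto
    thus "\<exists>s\<in>span ?S. f - s \<in> null" if "f \<in> forms 4 2" for f
      using that span_linear_form_products unfolding m_def by blast
  qed
  \<comment> \<open>Up to two elements of \<open>Y\<close> have at most 0, 1 or 3 distinct products,
    each time at most \<open>card Y + 1\<close>.\<close>
  have rank_le: "card D \<le> card DU + 1"
  proof -
    consider "card Y = 0" | "card Y = 1" | "card Y = 2" | "card Y = 3" | "card Y \<ge> 4" by linarith
    then show ?thesis
    proof cases
      case 1
      then show ?thesis using \<open>card D \<le> card ?S\<close> finY by simp
    next
      case 2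
      then show ?thesis using \<open>card D \<le> card ?S\<close> by (auto simp: card_1_singleton_iff)
    next
      case 3
      then obtain y1 y2 where "Y = {y1, y2}" by (auto simp: card_2_iff)
      hence "?S = {m y1 y1, m y1 y2, m y2 y2}" by (auto simp: m_def mult.commute)
      hence "card ?S \<le> 3" by (simp add: card_insert_if)
      then show ?thesis using \<open>card D \<le> card ?S\<close> 3 cardY by linarith
    next
      case 4
      \<comment> \<open>Three vectors do not span the four-dimensional space, so \<open>N\<close>
        contains a nonzero vector and \<open>rank_le_4\<close> applies.\<close>
      have "\<not> UNIV \<subseteq> span Y"
        using dim_le_card[OF _ finY, of UNIV] 4 by auto
      then obtain x where "x \<notin> span Y" by blast
      moreover obtain v where "v \<in> span Y" "x - v \<in> q.N" using decomp by blast
      ultimately have "x - v \<in> q.N" "x - v \<noteq> 0" by auto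
      then show ?thesis using rank_le_4[OF D] 4 cardY by fastforce
    next
      case 5
      then show ?thesis using D5 cardY by linarith
    qed
  qed
  have U_orth: "L (h * m a x) = 0" if h: "h \<in> forms 4 2" and orth: "\<And>e. e \<in> DU \<Longrightarrow> L (e * h) = 0" for h x
  proof -
    have "L ((m a x - proj DU (m a x)) * h) = 0" using projU h by (auto simp: null_def)
    moreover have "L (proj DU (m a x) * h) = 0" using orth by (simp add: b_proj)
    ultimately show ?thesis by (simp add: lin sym[of h])
  qed
  have proj_U: "proj DU f \<in> U" for f
    unfolding proj_def using sub_U DU_U by (auto intro!: subspace_sum subspace_scale)
  \<comment> \<open>In the flat case \<open>h = 0\<close>. Otherwise \<open>h\<close> extends
    \<open>DU\<close> by one unit vector, and \<open>rank_le\<close> leaves no room for a second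
    extension.\<close>
  obtain h where h: "h \<in> forms 4 2" "\<And>x. L (h * m a x) = 0" "L (h * h) = 0 \<or> L (h * h) = 1"
    and spanning: "\<And>f. f \<in> forms 4 2 \<Longrightarrow> \<exists>c. f - proj DU f - c *\<^sub>R h \<in> null"
  proof (cases "\<forall>f\<in>forms 4 2. f - proj DU f \<in> null")
    case True
    show thesis
      by (rule that[of 0]) (use True in \<open>auto simp: linear_0[OF lin_L] subspace_0[OF subspace_forms]\<close>)
  next
    case False
    then obtain f0 where "f0 \<in> forms 4 2" "f0 - proj DU f0 \<notin> null" by blast
    then obtain h where h: "orthonormal (insert h DU)" "h \<notin> DU"
      using orthonormal_extend[OF DU_o] by blast
    have card: "card (insert h DU) = card DU + 1" using h(2) DU_fin by simp
    show thesis
    proof (rule that[of h])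
      show hV: "h \<in> forms 4 2" using h(1) by (simp add: orthonormal_def)
      show "L (h * h) = 0 \<or> L (h * h) = 1" using h(1) by (simp add: orthonormal_def)
      show "L (h * m a x) = 0" for x
        using h by (intro U_orth[OF hV]) (auto simp: orthonormal_def)
      show "\<exists>c. f - proj DU f - c *\<^sub>R h \<in> null" if f: "f \<in> forms 4 2" for f
      proof -
        have "f - proj (insert h DU) f \<in> null"
        proof (rule ccontr)
          assume "f - proj (insert h DU) f \<notin> null"
          then obtain h' where "orthonormal (insert h' (insert h DU))" "h' \<notin> insert h DU"
            using orthonormal_extend[OF h(1) f] by blast
          thus False using orthonormal_card_le[OF D, of "insert h' (insert h DU)"] card rank_le DU_fin by simp
        qed
        moreover have "proj (insert h DU) f = L (f * h) *\<^sub>R h + proj DU f"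
          using h(2) DU_fin by (simp add: proj_def)
        ultimately show ?thesis by (intro exI[of _ "L (f * h)"]) (simp add: algebra_simps)
      qed
    qed
  qed
  interpret r: almost_flat_quartic "\<lambda>x y. linear_form x * linear_form y" "\<lambda>f g. L (f * g)" a h
  proof
    show "q.ker a = q.N" "L (linear_form a * linear_form a * (linear_form a * linear_form a)) = 1" by (fact a)+
    show "h \<in> q.H" "L (h * h) = 0 \<or> L (h * h) = 1" using h by (simp_all add: H_eq)
    show "L (h * (linear_form a * linear_form x)) = 0" for x using h(2)[of x] by (simp add: m_def)
    fix f assume "f \<in> q.H"
    then obtain c where c: "f - proj DU f - c *\<^sub>R h \<in> null" using spanning by (auto simp: H_eq)
    obtain x where x: "proj DU f = m a x" using proj_U[of f] by (auto simp: U_def)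
    have "L (f * g) = L (m a x * g) + c * L (h * g)" if "g \<in> q.H" for g
    proof -
      have "L ((f - proj DU f - c *\<^sub>R h) * g) = 0" using c that by (auto simp: null_def H_eq)
      thus ?thesis by (simp add: lin x)
    qed
    thus "\<exists>x c. \<forall>g\<in>q.H. L (f * g) = L (linear_form a * linear_form x * g) + c * L (h * g)"
      unfolding m_def by blast
  qed
  obtain z w where zw: "linear z" "z \<noteq> (\<lambda>_. 0)" "w \<in> q.H"
    "\<And>x y. L (w * (linear_form x * linear_form y)) = z x * z y"
    using r.evaluation_functional by auto
  obtain x0 where "z x0 \<noteq> 0" using zw(2) unfolding fun_eq_iff by blast
  moreover have "w \<in> forms 4 2" using zw(3) by (simp add: H_eq)
  ultimately show ?thesis using rank_1_of_evaluation[OF D zw(1) _ _ zw(4)] by blast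
qed

end

theorem theorem1p7:
  fixes l :: "real_mpoly \<Rightarrow> real"
  assumes "spans_extreme_ray l (sos_dual_cone 4 2)"
  shows "quadratic_form_rank (forms 4 2) (Q_form l) = 1 \<or>
         quadratic_form_rank (forms 4 2) (Q_form l) = 6"
proof -
  have "{c *\<^sub>R l |c. 0 \<le> c} \<subseteq> sos_dual_cone 4 2"
    using assms by (simp add: spans_extreme_ray_def face_of_imp_subset)
  moreover have "l \<in> {c *\<^sub>R l |c. 0 \<le> c}" by (auto intro!: exI[of _ "1 :: real"])
  ultimately have "l \<in> dual_space (forms 4 (2 * 2))" by (auto simp: sos_dual_cone_def)
  then obtain L where L: "linear L" "\<And>p. p \<in> forms 4 (2 * 2) \<Longrightarrow> L p = l p"
    using dual_space_linear_extension[OF _ subspace_forms] by blast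
  interpret extreme_quaternary_quartic l L
    by (intro extreme_quaternary_quartic.intro extreme_functional.intro) (use assms L in auto)
  obtain D where D: "parseval D" by (rule parseval_system)
  show ?thesis
    using rank_eq[OF D] rank_le_6[OF D] rank_1_of_rank_le_5[OF D] by linarith
qed

end
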